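(* Let $f\in S$ be a nonzero polynomial of degree $d$ (not necessarily quasi-homogeneous). Regard $D(f)^h$ as a graded submodule of the free $S^h$-module $S^h\langle\partial_{x_1},\dots,\partial_{x_n}\rangle\cong(S^h)^n$ in which each $\partial_{x_i}$ has degree $0$. Then $\chi(D(f)^h)=d$, where $\chi(M)=\big[(1-t)^{n+1}HP_M(t)\big]'(1)$ for a finitely generated graded $S^h$-module $M$.
   Context: $\mathbb K$ a field of characteristic zero, $S=\mathbb K[x_1,\dots,x_n]$, $S^h=\mathbb K[x_1,\dots,x_n,h]$ with the standard grading by total degree. $D(f)\subseteq\mathrm{Der}_{\mathbb K}(S)$: for $g\in S$, $e\ge1$, $D(g;e)=\{\delta:\delta(g)\in g^eS\}$, and for nonzero $f=cf_1^{e_1}\cdots f_r^{e_r}$ (pairwise non-associate irreducibles), $D(f)=\bigcap_iD(f_i;e_i)$. For nonzero $g\in S$ of degree $e$, $g^h=h^eg(x/h)$; for nonzero $\delta=\sum a_i\partial_{x_i}$ with $e=\max\deg a_i$, $\delta^h=\sum_{a_i\ne0}h^{e-\deg a_i}a_i^h\partial_{x_i}$; $D(f)^h$ is the $S^h$-submodule of $S^h\langle\partial_{x_1},\dots,\partial_{x_n}\rangle$ generated by all $\delta^h$, $0\neq\delta\in D(f)$. $HP_M(t)=\sum_j\dim_{\mathbb K}M_jt^j$. *)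

theory Defs
  imports "HOL-Library.Poly_Mapping" "HOL-Library.Function_Algebras" "HOL-Computational_Algebra.Computational_Algebra"
begin

text \<open>Polynomials over a field 'k in finitely many variables indexed by the finite
type 'v: S = ('n \<Rightarrow>0 nat) \<Rightarrow>0 'k, and S^h = ('n option \<Rightarrow>0 nat) \<Rightarrow>0 'k with
h = the variable None.\<close>

type_synonym ('v, 'k) mpoly = "('v \<Rightarrow>\<^sub>0 nat) \<Rightarrow>\<^sub>0 'k"

definition mdeg :: "('v \<Rightarrow>\<^sub>0 nat) \<Rightarrow> nat" where
  "mdeg m = (\<Sum>i\<in>Poly_Mapping.keys m. Poly_Mapping.lookup m i)"

text \<open>total degree (0 for the zero polynomial)\<close>
definition tdeg :: "('v, 'k::zero) mpoly \<Rightarrow> nat" where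
  "tdeg p = Max (insert 0 (mdeg ` Poly_Mapping.keys p))"

definition mvar :: "'v \<Rightarrow> ('v, 'k::{zero,one}) mpoly" where
  "mvar i = Poly_Mapping.single (Poly_Mapping.single i 1) 1"

definition mconst :: "'k \<Rightarrow> ('v, 'k::zero) mpoly" where
  "mconst c = Poly_Mapping.single 0 c"

definition pdiff :: "'v \<Rightarrow> ('v, 'k::comm_semiring_1) mpoly \<Rightarrow> ('v, 'k) mpoly" where
  "pdiff i p = (\<Sum>m\<in>Poly_Mapping.keys p. Poly_Mapping.single (m - Poly_Mapping.single i 1)
                               (of_nat (Poly_Mapping.lookup m i) * Poly_Mapping.lookup p m))"

text \<open>A derivation sum_i a_i d/dx_i is represented by its coefficient vector a.\<close>
definition app_der :: "('v::finite \<Rightarrow> ('v, 'k::comm_semiring_1) mpoly) \<Rightarrow> ('v, 'k) mpoly \<Rightarrow> ('v, 'k) mpoly" where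
  "app_der a g = (\<Sum>i\<in>UNIV. a i * pdiff i g)"

definition Dge :: "('v::finite, 'k::comm_ring_1) mpoly \<Rightarrow> nat \<Rightarrow> ('v \<Rightarrow> ('v, 'k) mpoly) set" where
  "Dge g e = {a. g ^ e dvd app_der a g}"

text \<open>D(f): intersection of D(f_i;e_i) over the irreducible factors f_i of f with
their multiplicities e_i (associate factors give the same condition).\<close>
definition Dlog :: "('v::finite, 'k::comm_ring_1) mpoly \<Rightarrow> ('v \<Rightarrow> ('v, 'k) mpoly) set" where
  "Dlog f = {a. \<forall>g e. irreducible g \<and> 1 \<le> e \<and> g ^ e dvd f \<and> \<not> g ^ Suc e dvd f
                     \<longrightarrow> a \<in> Dge g e}"

definition hmono :: "('v \<Rightarrow>\<^sub>0 nat) \<Rightarrow> nat \<Rightarrow> ('v option \<Rightarrow>\<^sub>0 nat)" where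
  "hmono m e = Abs_poly_mapping (\<lambda>k. case k of None \<Rightarrow> e | Some i \<Rightarrow> Poly_Mapping.lookup m i)"

definition homog :: "('v::finite, 'k::comm_monoid_add) mpoly \<Rightarrow> ('v option, 'k) mpoly" where
  "homog p = (\<Sum>m\<in>Poly_Mapping.keys p. Poly_Mapping.single (hmono m (tdeg p - mdeg m)) (Poly_Mapping.lookup p m))"

definition hvar :: "('v option, 'k::{zero,one}) mpoly" where
  "hvar = mvar None"

definition homog_der :: "('v::finite \<Rightarrow> ('v, 'k::comm_semiring_1) mpoly) \<Rightarrow> ('v \<Rightarrow> ('v option, 'k) mpoly)" where
  "homog_der a = (let e = Max (tdeg ` {a i | i. a i \<noteq> 0}) in
     (\<lambda>i. if a i = 0 then 0 else hvar ^ (e - tdeg (a i)) * homog (a i)))"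

definition gen_submod :: "('w \<Rightarrow> ('u, 'k::comm_semiring_1) mpoly) set \<Rightarrow> ('w \<Rightarrow> ('u, 'k) mpoly) set" where
  "gen_submod G = {v. \<exists>ps. set (map snd ps) \<subseteq> G \<and>
      v = (\<lambda>i. sum_list (map (\<lambda>(c, g). c * g i) ps))}"

definition Dlog_h :: "('v::finite, 'k::comm_ring_1) mpoly \<Rightarrow> ('v \<Rightarrow> ('v option, 'k) mpoly) set" where
  "Dlog_h f = gen_submod (homog_der ` (Dlog f - {\<lambda>_. 0}))"

definition homogeneous_of :: "nat \<Rightarrow> ('u, 'k::zero) mpoly \<Rightarrow> bool" where
  "homogeneous_of j p = (\<forall>m\<in>Poly_Mapping.keys p. mdeg m = j)"

definition graded_piece :: "('w \<Rightarrow> ('u, 'k::zero) mpoly) set \<Rightarrow> nat \<Rightarrow> ('w \<Rightarrow> ('u, 'k) mpoly) set" where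
  "graded_piece M j = {v \<in> M. \<forall>i. homogeneous_of j (v i)}"

definition kscale :: "'k \<Rightarrow> ('w \<Rightarrow> ('u, 'k::comm_semiring_1) mpoly) \<Rightarrow> ('w \<Rightarrow> ('u, 'k) mpoly)" where
  "kscale c v = (\<lambda>i. mconst c * v i)"

definition kdim :: "('w \<Rightarrow> ('u, 'k::field) mpoly) set \<Rightarrow> nat" where
  "kdim V = vector_space.dim kscale V"

definition hilb_series :: "('w \<Rightarrow> ('u, 'k::field) mpoly) set \<Rightarrow> int fps" where
  "hilb_series M = Abs_fps (\<lambda>j. int (kdim (graded_piece M j)))"

text \<open>chi(M) = [(1-t)^(N) HP_M(t)]'(1), N = number of variables of the ring (n+1);
this presupposes (1-t)^N HP_M(t) is a polynomial (Hilbert--Serre).\<close>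
definition has_chi :: "nat \<Rightarrow> ('w \<Rightarrow> ('u, 'k::field) mpoly) set \<Rightarrow> int \<Rightarrow> bool" where
  "has_chi N M c = (\<exists>p :: int poly. fps_of_poly p = (1 - fps_X) ^ N * hilb_series M
                                   \<and> poly (pderiv p) 1 = c)"

end

theory Submission
  imports Defs "HOL-Library.Product_Lexorder"
begin

text \<open>
  Dehomogenisation identifies the degree \<open>j\<close> part of \<open>D(f)\<^sup>h\<close> with the derivations in \<open>D(f)\<close> of
  degree at most \<open>j\<close>. Counting leading terms for a degree-compatible order turns the dimension of
  this space into a count of monomials in up-closed sets, so by Dickson's lemma
  \<open>(1 - t)\<^bsup>n+1\<^esup> HP(t)\<close> is a polynomial \<open>p\<close>. Its derivative at \<open>1\<close> is read off from the growth
  of the codimension of \<open>D(f)\<close>, which has to be \<open>d j\<^bsup>n-1\<^esup>/(n-1)!\<close> to leading order.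

  For the latter write \<open>f = g\<^sup>e f'\<close> with \<open>g\<close> irreducible and \<open>g\<close> not dividing \<open>f'\<close>, so that
  \<open>D(f) = D(f') \<inter> D(g;e)\<close>. The map \<open>\<delta> \<mapsto> \<delta>(g)\<close> embeds \<open>D(f')/D(f)\<close> into \<open>S/(g\<^sup>e)\<close>, raising degrees by
  at most \<open>deg g - 1\<close>; its image contains all multiples of the class of \<open>f' \<partial>g/\<partial>x\<close>, a nonzerodivisor
  modulo \<open>g\<close> for a suitable variable \<open>x\<close>. Hence the codimension grows like that of
  \<open>(g\<^sup>e)\<close>, namely \<open>e deg(g) j\<^bsup>n-1\<^esup>/(n-1)!\<close>, and induction on the degree of \<open>f\<close> finishes the proof.
\<close>

section \<open>Degrees and partial derivatives\<close>

text \<open>The codimension is compared with the space of all derivations, of dimension n binom(j+n,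
  n) in degree at most \<open>j\<close>. Multiplied by (1-t)^(n+1), that series becomes the constant
  n, so n - p belongs to the codimension. Growth of order j^(n-1) instead of j^n forces n - p =
  (t-1) r', and the growth constant d gives r'(1) = -d, hence p'(1) = d. Only leading constants
  matter: the number of monomials with degree in an interval of length m ending at k + const is m
  k^(n-1)/(n-1)! to leading order, whatever the constant. So the crude upper and lower bounds for
  one irreducible factor agree in the limit. D(f) is defined through irreducibles, but splitting off
  g^e and cancelling modulo g need primes. This is why unique factorisation is established, by
  induction on the set of variables allowed to occur, inside one fixed type. Characteristic zero
  supplies a variable x with dg/dx nonzero; having smaller degree than g, it is not divisible by g.
  The Hilbert-Serre part treats D(f) filtered by degree: passing from degree exactly j to degree at
  most j costs one factor 1-t, which accounts for the variable h.\<close>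

abbreviation lookup :: "('a \<Rightarrow>\<^sub>0 'b::zero) \<Rightarrow> 'a \<Rightarrow> 'b" where "lookup \<equiv> Poly_Mapping.lookup"
abbreviation keys :: "('a \<Rightarrow>\<^sub>0 'b::zero) \<Rightarrow> 'a set" where "keys \<equiv> Poly_Mapping.keys"
abbreviation single :: "'a \<Rightarrow> 'b \<Rightarrow> 'a \<Rightarrow>\<^sub>0 'b::zero" where "single \<equiv> Poly_Mapping.single"

lemma mdeg_eq_sum: "mdeg m = (\<Sum>i\<in>UNIV. lookup m i)" for m :: "'v::finite \<Rightarrow>\<^sub>0 nat"
  unfolding mdeg_def by (rule sum.mono_neutral_left) (auto simp: in_keys_iff)

lemma mdeg_add [simp]: "mdeg (a + b) = mdeg a + mdeg b" for a :: "'v::finite \<Rightarrow>\<^sub>0 nat"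
  by (simp add: mdeg_eq_sum lookup_add sum.distrib)

lemma mdeg_zero [simp]: "mdeg 0 = 0"
  by (simp add: mdeg_def)

lemma mdeg_single [simp]: "mdeg (single i k) = k"
  by (simp add: mdeg_def)

lemma mdeg_eq_0_iff [simp]: "mdeg m = 0 \<longleftrightarrow> m = 0" for m :: "'v::finite \<Rightarrow>\<^sub>0 nat"
proof
  assume "mdeg m = 0"
  then have "lookup m i = 0" for i by (simp add: mdeg_eq_sum)
  then show "m = 0" by (intro poly_mapping_eqI) simp
qed simp

lemma sum_single_lookup: "(\<Sum>m\<in>keys p. single m (lookup p m)) = p" for p :: "'a \<Rightarrow>\<^sub>0 'b::comm_monoid_add"
proof (rule poly_mapping_eqI)
  fix k
  have "lookup (\<Sum>m\<in>keys p. single m (lookup p m)) k = (\<Sum>m\<in>keys p. if m = k then lookup p m else 0)"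
    by (simp add: lookup_sum lookup_single when_def)
  also have "\<dots> = lookup p k"
    by (simp add: in_keys_iff)
  finally show "lookup (\<Sum>m\<in>keys p. single m (lookup p m)) k = lookup p k" .
qed

lemma mult_eq_sum_singles:
  "p * q = (\<Sum>m\<in>keys p. \<Sum>n\<in>keys q. single (m + n) (lookup p m * lookup q n))"
  for p q :: "'a::comm_monoid_add \<Rightarrow>\<^sub>0 'b::comm_semiring_0"
proof -
  have "p * q = (\<Sum>m\<in>keys p. single m (lookup p m)) * (\<Sum>n\<in>keys q. single n (lookup q n))"
    by (simp add: sum_single_lookup)
  then show ?thesis
    by (simp add: sum_product mult_single)
qed

lemma additive_sum:
  assumes "\<And>x y. F (x + y) = F x + F y" "F (0::'a::comm_monoid_add) = (0::'b::comm_monoid_add)"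
  shows "F (sum g A) = (\<Sum>x\<in>A. F (g x))"
  by (induction A rule: infinite_finite_induct) (simp_all add: assms)

text \<open>Both sides are biadditive and every polynomial is a sum of its terms. This serves all
  substitutions below that act on monomials.\<close>

lemma multiplicative_if_on_singles:
  fixes F :: "('a::comm_monoid_add \<Rightarrow>\<^sub>0 'b::comm_semiring_0) \<Rightarrow> 'c::comm_semiring_0"
  assumes add: "\<And>x y. F (x + y) = F x + F y" and zero: "F 0 = 0"
    and sgl: "\<And>m n c d. F (single (m + n) (c * d)) = F (single m c) * F (single n d)"
  shows "F (p * q) = F p * F q"
proof -
  have "F (p * q) = (\<Sum>m\<in>keys p. \<Sum>n\<in>keys q. F (single m (lookup p m)) * F (single n (lookup q n)))"
    by (simp add: mult_eq_sum_singles additive_sum[of F, OF add zero] sgl)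
  also have "\<dots> = F (\<Sum>m\<in>keys p. single m (lookup p m)) * F (\<Sum>m\<in>keys q. single m (lookup q m))"
    by (simp add: additive_sum[of F, OF add zero] sum_product)
  finally show ?thesis by (simp add: sum_single_lookup)
qed

lemma lookup_single_mult_add:
  "lookup (single s c * p) (s + m) = c * lookup p m"
  for p :: "'a::cancel_comm_monoid_add \<Rightarrow>\<^sub>0 'b::comm_semiring_0"
proof (cases "c = 0")
  case False
  have "lookup (single s c * p) (s + m) = (\<Sum>n\<in>keys p. if n = m then c * lookup p n else 0)"
    using False by (simp add: mult_eq_sum_singles lookup_sum lookup_single when_def)
  also have "\<dots> = c * lookup p m"
    by (auto simp: in_keys_iff)
  finally show ?thesis .
qed simp

lemma lookup_mconst_mult: "lookup (mconst c * p) m = c * lookup p m"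
  for p :: "('v, 'k::comm_semiring_1) mpoly"
  using lookup_single_mult_add[of 0 c p m] by (simp add: mconst_def)

lemma mdeg_le_tdeg: "m \<in> keys p \<Longrightarrow> mdeg m \<le> tdeg p"
  unfolding tdeg_def by (rule Max_ge) auto

lemma tdeg_le_iff: "tdeg p \<le> d \<longleftrightarrow> (\<forall>m\<in>keys p. mdeg m \<le> d)"
  unfolding tdeg_def by (subst Max_le_iff) auto

lemma tdeg_attained:
  assumes "p \<noteq> 0"
  obtains m where "m \<in> keys p" "mdeg m = tdeg p"
proof -
  have ne: "mdeg ` keys p \<noteq> {}" using assms by auto
  have "tdeg p = Max (mdeg ` keys p)"
    unfolding tdeg_def using ne by (simp add: Max_insert)
  with ne have "tdeg p \<in> mdeg ` keys p" by (metis Max_in finite_imageI finite_keys)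
  with that show thesis by auto
qed

lemma tdeg_zero [simp]: "tdeg 0 = 0"
  by (simp add: tdeg_def)

lemma tdeg_add_le: "tdeg p \<le> d \<Longrightarrow> tdeg q \<le> d \<Longrightarrow> tdeg (p + q) \<le> d"
  for p q :: "('v, 'k::comm_monoid_add) mpoly"
  using keys_add[of p q] by (auto simp: tdeg_le_iff)

lemma tdeg_sum_le: "(\<And>x. x \<in> A \<Longrightarrow> tdeg (g x) \<le> d) \<Longrightarrow> tdeg (sum g A) \<le> d"
  for g :: "'a \<Rightarrow> ('v, 'k::comm_monoid_add) mpoly"
  by (induction A rule: infinite_finite_induct) (auto intro: tdeg_add_le)

lemma tdeg_mult_le: "tdeg (p * q) \<le> tdeg p + tdeg q"
  for p q :: "('v::finite, 'k::comm_semiring_0) mpoly"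
  using keys_mult[of p q] by (fastforce simp: tdeg_le_iff intro: add_mono mdeg_le_tdeg)

lemma tdeg_mconst_mult_le: "tdeg (mconst c * p) \<le> tdeg p"
  for p :: "('v::finite, 'k::comm_semiring_1) mpoly"
proof -
  have "keys (mconst c * p) \<subseteq> keys p" by (auto simp: in_keys_iff lookup_mconst_mult)
  then show ?thesis by (auto simp: tdeg_le_iff intro: mdeg_le_tdeg)
qed

text \<open>Among the monomials of top degree take the largest one in the additive order on
  exponents. The sum of the two largest arises from one pair only, so its coefficient in the product
  is a product of two nonzero coefficients.\<close>

lemma tdeg_mult:
  fixes p q :: "('v::{finite,linorder}, 'k::idom) mpoly"
  assumes "p \<noteq> 0" "q \<noteq> 0"
  shows "tdeg (p * q) = tdeg p + tdeg q"
proof -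
  define top :: "('v, 'k) mpoly \<Rightarrow> 'v \<Rightarrow>\<^sub>0 nat" where
    "top p = Max {m \<in> keys p. mdeg m = tdeg p}" for p
  have top: "top p \<in> keys p" "mdeg (top p) = tdeg p"
    "\<And>m. m \<in> keys p \<Longrightarrow> mdeg m = tdeg p \<Longrightarrow> m \<le> top p" if "p \<noteq> 0" for p
  proof -
    have "{m \<in> keys p. mdeg m = tdeg p} \<noteq> {}" using tdeg_attained[OF that] by auto
    then have "top p \<in> {m \<in> keys p. mdeg m = tdeg p}"
      unfolding top_def by (intro Max_in) auto
    then show "top p \<in> keys p" "mdeg (top p) = tdeg p" by auto
    show "m \<le> top p" if "m \<in> keys p" "mdeg m = tdeg p" for m
      unfolding top_def using that by (intro Max_ge) auto
  qed
  have eq: "m = top p \<and> n = top q" if "m \<in> keys p" "n \<in> keys q" "m + n = top p + top q" for m n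
  proof -
    have "mdeg m + mdeg n = tdeg p + tdeg q"
      using arg_cong[OF that(3), of mdeg] assms by (simp add: top)
    with mdeg_le_tdeg[OF that(1)] mdeg_le_tdeg[OF that(2)]
    have "mdeg m = tdeg p" "mdeg n = tdeg q" by auto
    with that assms have le: "m \<le> top p" "n \<le> top q" by (auto intro: top)
    have "m = top p"
    proof (rule ccontr)
      assume "m \<noteq> top p"
      with le have "m + n < top p + top q" by (intro add_less_le_mono) auto
      with that(3) show False by simp
    qed
    with that(3) show ?thesis by simp
  qed
  have "lookup (p * q) (top p + top q) =
    (\<Sum>m\<in>keys p. \<Sum>n\<in>keys q. if m = top p \<and> n = top q then lookup p m * lookup q n else 0)"
    unfolding mult_eq_sum_singles lookup_sum lookup_single when_def
    by (intro sum.cong refl) (use eq in \<open>auto\<close>)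
  also have "\<dots> = (\<Sum>m\<in>keys p. if m = top p then \<Sum>n\<in>keys q. if n = top q then lookup p m * lookup q n else 0 else 0)"
    by (intro sum.cong refl) auto
  also have "\<dots> = lookup p (top p) * lookup q (top q)"
    using assms top by simp
  also have "\<dots> \<noteq> 0"
    using assms top(1) by (simp add: in_keys_iff)
  finally have "top p + top q \<in> keys (p * q)" by (simp add: in_keys_iff)
  from mdeg_le_tdeg[OF this] have "tdeg p + tdeg q \<le> tdeg (p * q)"
    using assms by (simp add: top)
  with tdeg_mult_le[of p q] show ?thesis by simp
qed

lemma tdeg_one [simp]: "tdeg (1 :: ('v::finite, 'k::comm_semiring_1) mpoly) = 0"
  by (simp add: tdeg_def)

lemma tdeg_power: "p \<noteq> 0 \<Longrightarrow> tdeg (p ^ k) = k * tdeg p"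
  for p :: "('v::{finite,linorder}, 'k::idom) mpoly"
  by (induction k) (simp_all add: tdeg_mult)

lemma tdeg_dvd_le: "p dvd q \<Longrightarrow> q \<noteq> 0 \<Longrightarrow> tdeg p \<le> tdeg q"
  for p :: "('v::{finite,linorder}, 'k::idom) mpoly"
  by (auto simp: dvd_def tdeg_mult)

lemma tdeg_eq_0_iff: "tdeg p = 0 \<longleftrightarrow> (\<exists>c. p = mconst c)"
  for p :: "('v::finite, 'k::comm_semiring_1) mpoly"
proof
  assume "tdeg p = 0"
  then have "keys p \<subseteq> {0}" using mdeg_le_tdeg[of _ p] by auto
  then have "p = mconst (lookup p 0)"
    by (intro poly_mapping_eqI) (auto simp: mconst_def lookup_single when_def in_keys_iff subset_iff)
  then show "\<exists>c. p = mconst c" ..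
qed (auto simp: mconst_def tdeg_def)

lemma mconst_mult: "mconst c * mconst d = mconst (c * d)"
  by (simp add: mconst_def mult_single)

lemma mconst_one: "mconst 1 = 1"
  by (simp add: mconst_def)

lemma mpoly_dvd_1_iff: "p dvd 1 \<longleftrightarrow> p \<noteq> 0 \<and> tdeg p = 0"
  for p :: "('v::{finite,linorder}, 'k::field) mpoly"
proof
  assume "p dvd 1"
  with tdeg_dvd_le[of p 1] show "p \<noteq> 0 \<and> tdeg p = 0" by auto
next
  assume *: "p \<noteq> 0 \<and> tdeg p = 0"
  then obtain c where c: "p = mconst c" by (auto simp: tdeg_eq_0_iff)
  with * have "c \<noteq> 0" by (auto simp: mconst_def)
  then have "p * mconst (inverse c) = 1" by (simp add: c mconst_mult mconst_one)
  then show "p dvd 1" by (metis dvd_triv_left)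
qed

section \<open>Partial derivatives\<close>

lemma lookup_pdiff:
  "lookup (pdiff i p) m = of_nat (lookup m i + 1) * lookup p (m + single i 1)"
  for p :: "('v, 'k::comm_semiring_1) mpoly"
proof -
  have "lookup (pdiff i p) m = (\<Sum>n\<in>keys p. if n = m + single i 1 then of_nat (lookup n i) * lookup p n else 0)"
    unfolding pdiff_def lookup_sum lookup_single when_def
  proof (intro sum.cong refl)
    fix n
    have "n - single i 1 = m \<longleftrightarrow> n = m + single i 1" if "lookup n i \<noteq> 0"
    proof
      assume "n - single i 1 = m"
      then have "lookup (n - single i 1) k + lookup (single i 1) k = lookup m k + lookup (single i 1) k" for k
        by simp
      moreover have "lookup (n - single i 1) k + lookup (single i 1) k = lookup n k" for k
        using that by (auto simp: lookup_minus lookup_single when_def)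
      ultimately show "n = m + single i 1"
        by (intro poly_mapping_eqI) (simp add: lookup_add)
    qed simp
    moreover have "lookup n i \<noteq> 0" if "n = m + single i 1"
      using that by (simp add: lookup_add)
    ultimately show "(if n - single i 1 = m then of_nat (lookup n i) * lookup p n else 0) =
      (if n = m + single i 1 then of_nat (lookup n i) * lookup p n else 0)"
      by (cases "lookup n i = 0") auto
  qed
  also have "\<dots> = of_nat (lookup m i + 1) * lookup p (m + single i 1)"
    by (auto simp: in_keys_iff lookup_add)
  finally show ?thesis .
qed

lemma pdiff_mconst_mult: "pdiff i (mconst c * p) = mconst c * pdiff i p"
  for p :: "('v, 'k::comm_semiring_1) mpoly"
  by (intro poly_mapping_eqI) (simp add: lookup_pdiff lookup_mconst_mult mult.left_commute)

lemma tdeg_pdiff: "tdeg (pdiff i p) \<le> tdeg p - 1"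
  for p :: "('v::finite, 'k::comm_semiring_1) mpoly"
  unfolding tdeg_le_iff
proof
  fix m assume "m \<in> keys (pdiff i p)"
  then have "m + single i 1 \<in> keys p" by (auto simp: in_keys_iff lookup_pdiff)
  from mdeg_le_tdeg[OF this] show "mdeg m \<le> tdeg p - 1" by simp
qed

text \<open>A monomial of top degree contains some variable; differentiating by it multiplies the
  coefficient by a positive exponent, which is nonzero in characteristic zero.\<close>

lemma pdiff_nonzero:
  fixes p :: "('v::finite, 'k::field_char_0) mpoly"
  assumes "0 < tdeg p"
  obtains i where "pdiff i p \<noteq> 0"
proof -
  have "p \<noteq> 0" using assms by auto
  then obtain m where m: "m \<in> keys p" "mdeg m = tdeg p" by (rule tdeg_attained)
  with assms have "m \<noteq> 0" by auto
  then obtain i where i: "lookup m i \<noteq> 0" by (metis lookup_zero poly_mapping_eqI)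
  have "m = (m - single i 1) + single i 1"
    using i by (intro poly_mapping_eqI) (auto simp: lookup_add lookup_minus lookup_single when_def)
  then have "lookup (pdiff i p) (m - single i 1) = of_nat (lookup (m - single i 1) i + 1) * lookup p m"
    by (metis lookup_pdiff)
  also have "\<dots> \<noteq> 0" using m by (simp add: in_keys_iff flip: of_nat_Suc del: of_nat_Suc)
  finally have "pdiff i p \<noteq> 0" by auto
  with that show thesis .
qed

section \<open>Unique factorisation in polynomial rings\<close>

text \<open>\<open>p\<close> as a univariate polynomial in \<open>x\<close>; its coefficients keep the type of \<open>p\<close> but do not
  involve \<open>x\<close>.\<close>

definition xpoly :: "'v \<Rightarrow> ('v, 'k::comm_semiring_1) mpoly \<Rightarrow> ('v, 'k) mpoly poly" where
  "xpoly x p = (\<Sum>m\<in>keys p. monom (single (m - single x (lookup m x)) (lookup p m)) (lookup m x))"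

lemma split_off_var: "n - single x (lookup n x) = m \<and> lookup n x = k \<longleftrightarrow> n = m + single x k \<and> lookup m x = 0"
  for n m :: "'v \<Rightarrow>\<^sub>0 nat"
proof
  assume *: "n - single x (lookup n x) = m \<and> lookup n x = k"
  then have m: "lookup m y = lookup n y - lookup (single x k) y" for y by (auto simp: lookup_minus)
  then have "lookup m x = 0" using * by simp
  moreover have "n = m + single x k"
    using * by (intro poly_mapping_eqI) (auto simp: lookup_add m lookup_single when_def)
  ultimately show "n = m + single x k \<and> lookup m x = 0" by simp
next
  assume *: "n = m + single x k \<and> lookup m x = 0"
  then have "lookup n x = k" by (simp add: lookup_add)
  with * show "n - single x (lookup n x) = m \<and> lookup n x = k" by simp
qed

lemma lookup_coeff_xpoly:
  "lookup (coeff (xpoly x p) k) m = (if lookup m x = 0 then lookup p (m + single x k) else 0)"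
proof -
  have "lookup (coeff (xpoly x p) k) m =
      (\<Sum>n\<in>keys p. if n - single x (lookup n x) = m \<and> lookup n x = k then lookup p n else 0)"
    unfolding xpoly_def coeff_sum lookup_sum
    by (intro sum.cong refl) (auto simp: lookup_single when_def)
  also have "\<dots> = (if lookup m x = 0 then lookup p (m + single x k) else 0)"
    unfolding split_off_var by (auto simp: in_keys_iff)
  finally show ?thesis .
qed

lemma xpoly_add: "xpoly x (p + q) = xpoly x p + xpoly x q"
  by (intro poly_eqI poly_mapping_eqI) (simp add: lookup_coeff_xpoly lookup_add)

lemma xpoly_zero [simp]: "xpoly x 0 = 0"
  by (simp add: xpoly_def)

lemma xpoly_diff: "xpoly x (p - q) = xpoly x p - xpoly x q"
  for p q :: "('v, 'k::comm_ring_1) mpoly"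
  by (intro poly_eqI poly_mapping_eqI) (simp add: lookup_coeff_xpoly lookup_minus)

lemma xpoly_single:
  "xpoly x (single m c) = monom (single (m - single x (lookup m x)) c) (lookup m x)"
  by (cases "c = 0") (simp_all add: xpoly_def)

lemma xpoly_mult: "xpoly x (p * q) = xpoly x p * xpoly x q"
proof (rule multiplicative_if_on_singles)
  fix m n :: "'a \<Rightarrow>\<^sub>0 nat" and c d :: 'b
  have "m + n - single x (lookup (m + n) x) = (m - single x (lookup m x)) + (n - single x (lookup n x))"
    by (intro poly_mapping_eqI) (auto simp: lookup_add lookup_minus lookup_single when_def)
  then show "xpoly x (single (m + n) (c * d)) = xpoly x (single m c) * xpoly x (single n d)"
    by (simp add: xpoly_single mult_monom mult_single lookup_add)
qed (simp_all add: xpoly_add)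

lemma mvar_power: "mvar x ^ k = (single (single x k) 1 :: ('v, 'k::comm_semiring_1) mpoly)"
  by (induction k) (simp_all add: mvar_def mult_single single_add[symmetric])

text \<open>Evaluation at the variable undoes \<open>xpoly\<close>. Thus \<open>xpoly\<close> is
  injective, and divisibility of univariate polynomials can be carried back.\<close>

lemma poly_xpoly_mvar: "poly (xpoly x p) (mvar x) = p"
proof -
  have "m - single x (lookup m x) + single x (lookup m x) = m" for m :: "'a \<Rightarrow>\<^sub>0 nat"
    by (intro poly_mapping_eqI) (auto simp: lookup_add lookup_minus lookup_single when_def)
  then have "poly (xpoly x p) (mvar x) = (\<Sum>m\<in>keys p. single m (lookup p m))"
    unfolding xpoly_def poly_sum poly_monom mvar_power mult_single by simp
  then show ?thesis by (simp add: sum_single_lookup)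
qed

lemma xpoly_eq_0_iff [simp]: "xpoly x p = 0 \<longleftrightarrow> p = 0"
  by (metis poly_xpoly_mvar xpoly_zero poly_0)

text \<open>The subring K[A], kept as a subset of one polynomial type so that an induction on
  \<open>A\<close> does not have to change the type of variables.\<close>

definition mpolys :: "'v set \<Rightarrow> ('v, 'k::zero) mpoly set" where
  "mpolys A = {p. \<forall>m\<in>keys p. keys m \<subseteq> A}"

lemma degree_xpoly_0_iff: "degree (xpoly x p) = 0 \<longleftrightarrow> (\<forall>m\<in>keys p. lookup m x = 0)"
proof
  assume deg: "degree (xpoly x p) = 0"
  show "\<forall>m\<in>keys p. lookup m x = 0"
  proof
    fix m assume m: "m \<in> keys p"
    define n where "n = m - single x (lookup m x)"
    have n: "m = n + single x (lookup m x) \<and> lookup n x = 0"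
      using split_off_var[of m x n "lookup m x"] by (simp add: n_def)
    have "lookup (coeff (xpoly x p) (lookup m x)) n \<noteq> 0"
      using m n by (simp add: lookup_coeff_xpoly in_keys_iff)
    then have "coeff (xpoly x p) (lookup m x) \<noteq> 0" by auto
    then show "lookup m x = 0" using deg le_degree by fastforce
  qed
next
  assume *: "\<forall>m\<in>keys p. lookup m x = 0"
  have "coeff (xpoly x p) k = 0" if "k > 0" for k
  proof (rule poly_mapping_eqI)
    fix m
    have "m + single x k \<notin> keys p" using * that by (auto simp: lookup_add)
    then show "lookup (coeff (xpoly x p) k) m = lookup 0 m"
      by (simp add: lookup_coeff_xpoly in_keys_iff)
  qed
  then have "degree (xpoly x p) \<le> 0" by (intro degree_le) simp
  then show "degree (xpoly x p) = 0" by simp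
qed

text \<open>Turns membership in K[A] into degree conditions, one per missing variable; closure under
  products and under factors then follows from the behaviour of degrees.\<close>

lemma mpolys_iff_degree: "p \<in> mpolys A \<longleftrightarrow> (\<forall>y. y \<notin> A \<longrightarrow> degree (xpoly y p) = 0)"
  unfolding mpolys_def degree_xpoly_0_iff by (auto simp: in_keys_iff subset_iff)

lemma mpolys_UNIV [simp]: "mpolys UNIV = UNIV"
  by (simp add: mpolys_def)

lemma mpolys_mono: "A \<subseteq> B \<Longrightarrow> mpolys A \<subseteq> mpolys B"
  by (fastforce simp: mpolys_def)

lemma zero_in_mpolys [simp]: "0 \<in> mpolys A"
  by (simp add: mpolys_def)

lemma one_in_mpolys [simp]: "1 \<in> mpolys A"
  by (simp add: mpolys_def)

lemma mvar_in_mpolys: "x \<in> A \<Longrightarrow> mvar x \<in> mpolys A"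
  by (auto simp: mpolys_def mvar_def split: if_splits)

lemma mpolys_add: "p \<in> mpolys A \<Longrightarrow> q \<in> mpolys A \<Longrightarrow> p + q \<in> mpolys A"
  for p q :: "('v, 'k::comm_semiring_1) mpoly"
  using keys_add[of p q] by (fastforce simp: mpolys_def)

lemma mpolys_diff: "p \<in> mpolys A \<Longrightarrow> q \<in> mpolys A \<Longrightarrow> p - q \<in> mpolys A"
  for p q :: "('v, 'k::comm_ring_1) mpoly"
proof -
  have "keys (p - q) \<subseteq> keys p \<union> keys q" by (auto simp: in_keys_iff lookup_minus)
  then show "p \<in> mpolys A \<Longrightarrow> q \<in> mpolys A \<Longrightarrow> p - q \<in> mpolys A"
    by (fastforce simp: mpolys_def)
qed

lemma mpolys_mult: "p \<in> mpolys A \<Longrightarrow> q \<in> mpolys A \<Longrightarrow> p * q \<in> mpolys A"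
  for p q :: "('v, 'k::comm_semiring_1) mpoly"
  unfolding mpolys_iff_degree xpoly_mult by (metis add_0 degree_mult_le le_zero_eq)

lemma mpolys_power: "p \<in> mpolys A \<Longrightarrow> p ^ k \<in> mpolys A"
  for p :: "('v, 'k::comm_semiring_1) mpoly"
  by (induction k) (auto intro: mpolys_mult)

lemma mpolys_factor:
  fixes p q :: "('v::linorder, 'k::idom) mpoly"
  assumes "p * q \<in> mpolys A" "p * q \<noteq> 0"
  shows "p \<in> mpolys A" "q \<in> mpolys A"
proof -
  have "degree (xpoly y (p * q)) = degree (xpoly y p) + degree (xpoly y q)" for y
    using assms by (simp add: xpoly_mult degree_mult_eq)
  with assms show "p \<in> mpolys A" "q \<in> mpolys A"
    by (simp_all add: mpolys_iff_degree)
qed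

lemma coeff_xpoly_in_mpolys:
  assumes "p \<in> mpolys (insert x A)"
  shows "coeff (xpoly x p) k \<in> mpolys A"
  unfolding mpolys_def
proof (intro CollectI ballI subsetI)
  fix m y assume "m \<in> keys (coeff (xpoly x p) k)" and y: "y \<in> keys m"
  then have m: "lookup m x = 0" "m + single x k \<in> keys p"
    by (auto simp: in_keys_iff lookup_coeff_xpoly split: if_splits)
  from y have "y \<in> keys (m + single x k)" by (simp add: in_keys_iff lookup_add)
  with m assms have "y \<in> insert x A" by (auto simp: mpolys_def)
  with y m show "y \<in> A" by (auto simp: in_keys_iff)
qed

lemma xpoly_const:
  assumes "c \<in> mpolys A" "x \<notin> A"
  shows "xpoly x c = [:c:]"
proof -
  have "degree (xpoly x c) = 0" using assms by (simp add: mpolys_iff_degree)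
  then obtain d where d: "xpoly x c = [:d:]" by (metis degree_eq_zeroE)
  with poly_xpoly_mvar[of x c] show ?thesis by simp
qed

text \<open>Since \<open>c\<close> is free of \<open>x\<close>, it becomes a constant of the
  univariate ring. Conversely, a univariate quotient is evaluated at the variable, whether or not
  its coefficients are free of \<open>x\<close>.\<close>

lemma const_dvd_iff_coeffs:
  fixes c p :: "('v::linorder, 'k::idom) mpoly"
  assumes "c \<in> mpolys A" "x \<notin> A"
  shows "c dvd p \<longleftrightarrow> (\<forall>k. c dvd coeff (xpoly x p) k)"
proof -
  have "c dvd p \<longleftrightarrow> [:c:] dvd xpoly x p"
  proof
    assume "c dvd p"
    then show "[:c:] dvd xpoly x p" by (auto simp: dvd_def xpoly_mult xpoly_const[OF assms])
  next
    assume "[:c:] dvd xpoly x p"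
    then obtain Q where "xpoly x p = [:c:] * Q" ..
    then have "poly (xpoly x p) (mvar x) = c * poly Q (mvar x)" by simp
    then show "c dvd p" by (simp add: poly_xpoly_mvar)
  qed
  then show ?thesis by (simp add: const_poly_dvd_iff)
qed

text \<open>A nonunit divisor of least degree cannot split into two nonunits.\<close>

lemma exists_irreducible_factor:
  fixes p :: "('v::{finite,linorder}, 'k::field) mpoly"
  assumes "p \<noteq> 0" "\<not> p dvd 1"
  obtains d where "irreducible d" "d dvd p"
proof -
  define P where "P d \<longleftrightarrow> d dvd p \<and> \<not> d dvd 1" for d
  have "P p" using assms by (simp add: P_def)
  then obtain d where d: "P d" and min: "\<And>d'. P d' \<Longrightarrow> tdeg d \<le> tdeg d'"
    using ex_has_least_nat[of P p tdeg] by auto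
  have "d \<noteq> 0" using d assms by (auto simp: P_def)
  have "irreducible d"
  proof (rule irreducibleI)
    fix a b assume ab: "d = a * b"
    show "a dvd 1 \<or> b dvd 1"
    proof (rule ccontr)
      assume *: "\<not> (a dvd 1 \<or> b dvd 1)"
      with ab d have "P a" by (auto simp: P_def)
      then have "tdeg d \<le> tdeg a" by (rule min)
      with ab \<open>d \<noteq> 0\<close> have "tdeg b = 0" by (simp add: tdeg_mult)
      with * ab \<open>d \<noteq> 0\<close> show False by (simp add: mpoly_dvd_1_iff)
    qed
  qed (use d \<open>d \<noteq> 0\<close> in \<open>auto simp: P_def\<close>)
  with d that show thesis by (auto simp: P_def)
qed

section \<open>Primality of irreducibles: from K[A] to K[A, x]\<close>

context
  fixes A :: "'v::{finite,linorder} set" and x :: 'v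
  assumes x_notin: "x \<notin> A"
    and IH: "\<And>c g h :: ('v, 'k::field) mpoly. irreducible c \<Longrightarrow> c \<in> mpolys A \<Longrightarrow> g \<in> mpolys A \<Longrightarrow> h \<in> mpolys A
      \<Longrightarrow> c dvd g * h \<Longrightarrow> c dvd g \<or> c dvd h"
begin

text \<open>Gauss's lemma: if \<open>i\<close> and \<open>j\<close> index the first coefficients of
  \<open>g\<close> and \<open>h\<close> not divisible by \<open>c\<close>, then modulo
  \<open>c\<close> the coefficient of the product at \<open>i + j\<close> is the product of these
  two, and \<open>c\<close> is prime on K[A] by \<open>IH\<close>.\<close>

lemma Gauss_const:
  fixes c g h :: "('v, 'k) mpoly"
  assumes c: "irreducible c" "c \<in> mpolys A"
    and gh: "g \<in> mpolys (insert x A)" "h \<in> mpolys (insert x A)" and dvd: "c dvd g * h"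
  shows "c dvd g \<or> c dvd h"
proof (rule ccontr)
  assume contra: "\<not> (c dvd g \<or> c dvd h)"
  define G H where "G = xpoly x g" and "H = xpoly x h"
  note dvd_iff = const_dvd_iff_coeffs[OF c(2) x_notin]
  have exG: "\<exists>k. \<not> c dvd coeff G k" and exH: "\<exists>k. \<not> c dvd coeff H k"
    using contra dvd_iff[of g] dvd_iff[of h] by (auto simp: G_def H_def)
  define i j where "i = (LEAST k. \<not> c dvd coeff G k)" and "j = (LEAST k. \<not> c dvd coeff H k)"
  have i: "\<not> c dvd coeff G i" "\<And>k. k < i \<Longrightarrow> c dvd coeff G k"
    unfolding i_def using LeastI_ex[OF exG] not_less_Least by blast+
  have j: "\<not> c dvd coeff H j" "\<And>k. k < j \<Longrightarrow> c dvd coeff H k"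
    unfolding j_def using LeastI_ex[OF exH] not_less_Least by blast+
  have "c dvd (\<Sum>k\<in>{..i+j} - {i}. coeff G k * coeff H (i + j - k))"
  proof (rule dvd_sum)
    fix k assume "k \<in> {..i+j} - {i}"
    then consider "k < i" | "i + j - k < j" by fastforce
    then show "c dvd coeff G k * coeff H (i + j - k)"
      by cases (auto intro: i(2) j(2) dvd_mult dvd_mult2)
  qed
  moreover have "c dvd coeff (G * H) (i + j)"
    using dvd dvd_iff[of "g * h"] by (simp add: G_def H_def xpoly_mult)
  moreover have "coeff (G * H) (i + j) = coeff G i * coeff H j + (\<Sum>k\<in>{..i+j} - {i}. coeff G k * coeff H (i + j - k))"
    unfolding coeff_mult by (subst sum.remove[of _ i]) auto
  ultimately have "c dvd coeff G i * coeff H j"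
    by (simp add: dvd_add_left_iff)
  moreover have "coeff G i \<in> mpolys A" "coeff H j \<in> mpolys A"
    using gh by (auto simp: G_def H_def intro: coeff_xpoly_in_mpolys)
  ultimately show False using IH[OF c] i(1) j(1) by blast
qed

text \<open>Brings a factorisation with denominator \<open>c\<close> down to the ring. Irreducible
  factors of \<open>c\<close> are cancelled one at a time, each against \<open>q\<close> or
  \<open>r\<close> by \<open>Gauss_const\<close>; when only a unit is left, its inverse is absorbed
  into \<open>q'\<close>.\<close>

lemma const_mult_split:
  fixes c p q r :: "('v, 'k) mpoly"
  assumes "c \<in> mpolys A" "p \<in> mpolys (insert x A)" "c \<noteq> 0" "p \<noteq> 0" "c * p = q * r"
  shows "\<exists>c1 c2 q' r'. c1 \<in> mpolys A \<and> c2 \<in> mpolys A \<and> q = c1 * q' \<and> r = c2 * r' \<and> p = q' * r'"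
  using assms
proof (induction "tdeg c" arbitrary: c q r rule: less_induct)
  case less
  show ?case
  proof (cases "c dvd 1")
    case True
    then obtain c' where c': "c * c' = 1" by (metis dvdE)
    have "q = c * (c' * q)" "p = (c' * q) * r"
    proof -
      show "q = c * (c' * q)" by (metis c' mult.assoc mult_1)
      have "p = c' * (c * p)" by (metis c' mult.assoc mult.commute mult_1)
      then show "p = (c' * q) * r" by (simp add: less.prems mult.assoc)
    qed
    with less.prems show ?thesis by (intro exI[of _ c] exI[of _ 1] exI[of _ "c' * q"] exI[of _ r]) auto
  next
    case False
    with less.prems obtain d where d: "irreducible d" "d dvd c" by (metis exists_irreducible_factor)
    then obtain c' where c': "c = d * c'" by (metis dvdE)
    with less.prems have dA: "d \<in> mpolys A" "c' \<in> mpolys A" using mpolys_factor[of d c' A] by auto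
    have cp: "c * p \<in> mpolys (insert x A)" "c * p \<noteq> 0"
      using less.prems subsetD[OF mpolys_mono[of A "insert x A", OF subset_insertI]]
      by (blast intro: mpolys_mult) (metis less.prems(3,4) mult_eq_0_iff)
    have qr: "q \<in> mpolys (insert x A)" "r \<in> mpolys (insert x A)"
      using cp mpolys_factor[of q r] less.prems by auto
    have nz: "d \<noteq> 0" "c' \<noteq> 0" using c' less.prems by auto
    have "\<not> d dvd 1" using d by (auto simp: irreducible_def)
    then have "tdeg c' < tdeg c" using nz by (simp add: c' tdeg_mult mpoly_dvd_1_iff)
    note IH' = less.hyps[OF this dA(2) less.prems(2) nz(2) less.prems(4)]
    have "d dvd q * r" using less.prems(5) c' by (metis dvd_triv_left mult.assoc)
    with Gauss_const d dA qr have "d dvd q \<or> d dvd r" by blast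
    then show ?thesis
    proof
      assume "d dvd q"
      then obtain q'' where q'': "q = d * q''" ..
      then have "c' * p = q'' * r" using less.prems(5) nz c' by (simp add: mult.assoc)
      from IH'[OF this] obtain c1 c2 q' r' where
        *: "c1 \<in> mpolys A" "c2 \<in> mpolys A" "q'' = c1 * q'" "r = c2 * r'" "p = q' * r'" by blast
      then show ?thesis
        by (intro exI[of _ "d * c1"] exI[of _ c2] exI[of _ q'] exI[of _ r'])
          (auto simp: q'' mult.assoc intro: mpolys_mult dA)
    next
      assume "d dvd r"
      then obtain r'' where r'': "r = d * r''" ..
      then have "d * (c' * p) = d * (q * r'')" using less.prems(5) c' by (simp add: ac_simps)
      then have "c' * p = q * r''" using nz by simp
      from IH'[OF this] obtain c1 c2 q' r' where
        *: "c1 \<in> mpolys A" "c2 \<in> mpolys A" "q = c1 * q'" "r'' = c2 * r'" "p = q' * r'" by blast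
      then show ?thesis
        by (intro exI[of _ "c1"] exI[of _ "d * c2"] exI[of _ q'] exI[of _ r'])
          (auto simp: r'' mult.assoc intro: mpolys_mult dA)
    qed
  qed
qed

text \<open>After clearing \<open>c\<close>, irreducibility of \<open>p = c1 * p'\<close> leaves two
  cases. If \<open>c1\<close> is a unit, \<open>p\<close> is associated to \<open>p'\<close>, a
  factor of \<open>u\<close>; if \<open>p'\<close> is a unit, \<open>p\<close> would lie in
  K[A].\<close>

lemma irreducible_dvd_const_mult:
  fixes p c u :: "('v, 'k) mpoly"
  assumes p: "irreducible p" "p \<notin> mpolys A"
    and c: "c \<in> mpolys A" "c \<noteq> 0" and u: "u \<in> mpolys (insert x A)" and dvd: "p dvd c * u"
  shows "p dvd u"
proof (cases "u = 0")
  case False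
  from dvd obtain s where "c * u = p * s" ..
  from const_mult_split[OF c(1) u c(2) False this] obtain c1 c2 p' s' where
    *: "c1 \<in> mpolys A" "c2 \<in> mpolys A" "p = c1 * p'" "s = c2 * s'" "u = p' * s'" by blast
  have "c1 dvd 1 \<or> p' dvd 1" using p *(3) by (auto simp: irreducible_def)
  then show ?thesis
  proof
    assume "c1 dvd 1"
    then have "c1 * p' dvd 1 * p'" by (rule mult_dvd_mono) simp
    with * show ?thesis by (metis dvd_mult2 mult_1)
  next
    assume "p' dvd 1"
    then have "p' \<in> mpolys A" using mpolys_factor[of p'] by (metis dvdE one_in_mpolys one_neq_zero)
    with * p show ?thesis by (auto intro: mpolys_mult)
  qed
qed simp

text \<open>Division with remainder in \<open>x\<close>, where the multiplier \<open>c\<close>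
  replaces the division by leading coefficients that K[A] does not allow.\<close>

lemma pseudo_division:
  fixes r y :: "('v, 'k) mpoly"
  assumes r: "r \<in> mpolys (insert x A)" "r \<noteq> 0" and "y \<in> mpolys (insert x A)"
  shows "\<exists>c q s. c \<in> mpolys A \<and> c \<noteq> 0 \<and> q \<in> mpolys (insert x A) \<and> c * y = q * r + s \<and>
    (s = 0 \<or> degree (xpoly x s) < degree (xpoly x r))"
  using assms(3)
proof (induction "degree (xpoly x y)" arbitrary: y rule: less_induct)
  case less
  note sub = subsetD[OF mpolys_mono[of A "insert x A", OF subset_insertI]]
  show ?case
  proof (cases "y = 0 \<or> degree (xpoly x y) < degree (xpoly x r)")
    case True
    then show ?thesis by (intro exI[of _ 1] exI[of _ 0] exI[of _ y]) auto
  next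
    case False
    define k a b where "k = degree (xpoly x y) - degree (xpoly x r)"
      and "a = lead_coeff (xpoly x r)" and "b = lead_coeff (xpoly x y)"
    have ab: "a \<in> mpolys A" "b \<in> mpolys A" "a \<noteq> 0" "b \<noteq> 0"
      using r less.prems False by (auto simp: a_def b_def intro: coeff_xpoly_in_mpolys)
    \<comment> \<open>Cross-multiplying by the leading coefficients cancels the top power of
      \<open>x\<close>.\<close>
    define y' where "y' = a * y - b * mvar x ^ k * r"
    have y'A: "y' \<in> mpolys (insert x A)"
      unfolding y'_def using less.prems r ab
      by (intro mpolys_diff mpolys_mult mpolys_power mvar_in_mpolys) (auto intro: sub)
    have mv: "xpoly x (mvar x ^ k :: ('v, 'k) mpoly) = monom 1 k"
      by (simp add: mvar_power xpoly_single)
    have xy': "xpoly x y' = smult a (xpoly x y) - smult b (monom 1 k * xpoly x r)"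
      by (simp add: y'_def xpoly_diff xpoly_mult xpoly_const[OF ab(1) x_notin] xpoly_const[OF ab(2) x_notin] mv mult.assoc)
    have deg: "degree (monom 1 k * xpoly x r) = degree (xpoly x y)"
      using r False by (simp add: degree_mult_eq degree_monom_eq k_def)
    have "degree (xpoly x y') \<le> degree (xpoly x y)"
      unfolding xy' by (rule degree_diff_le) (simp_all add: deg degree_smult_le)
    moreover have "coeff (xpoly x y') (degree (xpoly x y)) = 0"
    proof -
      have "coeff (monom 1 k * xpoly x r) (degree (xpoly x y)) = a"
        using False by (simp add: coeff_monom_mult k_def a_def)
      then show ?thesis by (simp add: xy' b_def mult.commute)
    qed
    ultimately have "xpoly x y' = 0 \<or> degree (xpoly x y') < degree (xpoly x y)"
      by (rule eq_zero_or_degree_less)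
    then have "\<exists>c q s. c \<in> mpolys A \<and> c \<noteq> 0 \<and> q \<in> mpolys (insert x A) \<and> c * y' = q * r + s \<and>
        (s = 0 \<or> degree (xpoly x s) < degree (xpoly x r))"
    proof
      assume "xpoly x y' = 0"
      then show ?thesis by (intro exI[of _ 1] exI[of _ 0]) auto
    next
      assume "degree (xpoly x y') < degree (xpoly x y)"
      from less.hyps[OF this y'A] show ?thesis .
    qed
    then obtain c q s where cqs: "c \<in> mpolys A" "c \<noteq> 0" "q \<in> mpolys (insert x A)" "c * y' = q * r + s"
        "s = 0 \<or> degree (xpoly x s) < degree (xpoly x r)" by blast
    have "c * a * y = (q + c * b * mvar x ^ k) * r + s"
      using cqs(4) by (simp add: y'_def algebra_simps)
    moreover have "q + c * b * mvar x ^ k \<in> mpolys (insert x A)"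
      using cqs ab by (intro mpolys_add mpolys_mult mpolys_power mvar_in_mpolys) (auto intro: sub)
    ultimately show ?thesis using cqs ab
      by (intro exI[of _ "c * a"] exI[of _ "q + c * b * mvar x ^ k"] exI[of _ s]) (auto intro: mpolys_mult)
  qed
qed

text \<open>An element \<open>r\<close> of least \<open>x\<close>-degree in the ideal generated by \<open>p\<close> and \<open>g\<close> plays the role of
  their gcd over the fraction field of the coefficients; primes of the coefficient ring
  clear the denominators.\<close>

lemma Gauss_step:
  fixes p g h :: "('v, 'k) mpoly"
  assumes p: "irreducible p" "p \<in> mpolys (insert x A)"
    and gh: "g \<in> mpolys (insert x A)" "h \<in> mpolys (insert x A)" and dvd: "p dvd g * h"
  shows "p dvd g \<or> p dvd h"
proof (cases "p \<in> mpolys A")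
  case True
  with Gauss_const p gh dvd show ?thesis by blast
next
  case False
  note sub = subsetD[OF mpolys_mono[of A "insert x A", OF subset_insertI]]
  define P where "P r \<longleftrightarrow> r \<noteq> 0 \<and> (\<exists>a\<in>mpolys (insert x A). \<exists>b\<in>mpolys (insert x A). r = a * p + b * g)" for r
  have "p \<noteq> 0" using p by (auto simp: irreducible_def)
  then have "P p" unfolding P_def by (intro conjI bexI[of _ 1] bexI[of _ 0]) auto
  then obtain r where r: "P r" and min: "\<And>s. P s \<Longrightarrow> degree (xpoly x r) \<le> degree (xpoly x s)"
    using ex_has_least_nat[of P p "\<lambda>r. degree (xpoly x r)"] by auto
  from r obtain a b where ab: "a \<in> mpolys (insert x A)" "b \<in> mpolys (insert x A)" "r = a * p + b * g" "r \<noteq> 0"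
    by (auto simp: P_def)
  have rA: "r \<in> mpolys (insert x A)" using ab p gh by (auto intro: mpolys_add mpolys_mult)
  have multiple: "\<exists>c q. c \<in> mpolys A \<and> c \<noteq> 0 \<and> c * y = q * r"
    if y: "y = a' * p + b' * g" "a' \<in> mpolys (insert x A)" "b' \<in> mpolys (insert x A)" for y a' b'
  proof -
    have "y \<in> mpolys (insert x A)" using y p gh by (auto intro: mpolys_add mpolys_mult)
    from pseudo_division[OF rA \<open>r \<noteq> 0\<close> this] obtain c q s where
      *: "c \<in> mpolys A" "c \<noteq> 0" "q \<in> mpolys (insert x A)" "c * y = q * r + s"
        "s = 0 \<or> degree (xpoly x s) < degree (xpoly x r)" by blast
    \<comment> \<open>The remainder lies again in the ideal generated by \<open>p\<close> and
      \<open>g\<close>, so minimality of \<open>r\<close> forces it to vanish.\<close>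
    have "s = c * y - q * r" using * by simp
    then have "s = (c * a' - q * a) * p + (c * b' - q * b) * g"
      by (simp add: y ab algebra_simps)
    then have "s \<noteq> 0 \<Longrightarrow> P s"
      unfolding P_def using * y ab by (auto intro!: mpolys_diff mpolys_mult intro: sub)
    with *(5) min have "s = 0" by fastforce
    with * show ?thesis by auto
  qed
  \<comment> \<open>Up to factors from K[A], \<open>r\<close> divides both \<open>p\<close> and
    \<open>g\<close>. As \<open>p\<close> is irreducible, either \<open>p\<close> divides
    \<open>r\<close>, hence a K[A]-multiple of \<open>g\<close>, or \<open>r\<close> is free of
    \<open>x\<close> and \<open>p\<close> divides \<open>r * h\<close>.\<close>
  from multiple[of p 1 0] obtain c q where cq: "c \<in> mpolys A" "c \<noteq> 0" "c * p = q * r" by auto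
  from const_mult_split[OF cq(1) p(2) cq(2) \<open>p \<noteq> 0\<close> cq(3)] obtain c1 c2 q' r' where
    *: "c1 \<in> mpolys A" "c2 \<in> mpolys A" "q = c1 * q'" "r = c2 * r'" "p = q' * r'" by blast
  have "q' dvd 1 \<or> r' dvd 1" using p *(5) by (auto simp: irreducible_def)
  then show ?thesis
  proof
    assume "q' dvd 1"
    then have "q' * r' dvd 1 * r'" by (rule mult_dvd_mono) simp
    then have "p dvd r'" by (simp only: *(5)[symmetric] mult_1)
    then have "p dvd r" by (simp add: *(4))
    from multiple[of g 0 1] obtain c' q'' where c': "c' \<in> mpolys A" "c' \<noteq> 0" "c' * g = q'' * r" by auto
    with \<open>p dvd r\<close> have "p dvd c' * g" by simp
    with irreducible_dvd_const_mult[OF p(1) False c'(1,2) gh(1)] show ?thesis by simp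
  next
    assume "r' dvd 1"
    then have "r' \<in> mpolys A" using mpolys_factor[of r'] by (metis dvdE one_in_mpolys one_neq_zero)
    then have "r \<in> mpolys A" using * by (auto intro: mpolys_mult)
    moreover have "p dvd r * h"
    proof -
      have "r * h = p * (a * h) + b * (g * h)" by (simp add: ab algebra_simps)
      with dvd show ?thesis by simp
    qed
    ultimately show ?thesis using irreducible_dvd_const_mult[OF p(1) False _ \<open>r \<noteq> 0\<close> gh(2)] by simp
  qed
qed

end

text \<open>Without variables only constants remain, and none of them is irreducible.\<close>

lemma irreducible_imp_prime_on_mpolys:
  fixes p g h :: "('v::{finite,linorder}, 'k::field) mpoly"
  assumes "finite A"
  shows "irreducible p \<Longrightarrow> p \<in> mpolys A \<Longrightarrow> g \<in> mpolys A \<Longrightarrow> h \<in> mpolys A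
      \<Longrightarrow> p dvd g * h \<Longrightarrow> p dvd g \<or> p dvd h"
  using assms
proof (induction A arbitrary: p g h rule: finite_induct)
  case empty
  have "keys p \<subseteq> {0}" using empty(2) by (auto simp: mpolys_def)
  then have "tdeg p = 0" using tdeg_le_iff[of p 0] by auto
  with empty(1) show ?case by (auto simp: irreducible_def mpoly_dvd_1_iff)
next
  case (insert x A)
  show ?case
    by (rule Gauss_step[OF insert.hyps(2) insert.IH insert.prems])
qed

lemma irreducible_imp_prime_elem_mpoly:
  fixes p :: "('v::{finite,linorder}, 'k::field) mpoly"
  assumes "irreducible p"
  shows "prime_elem p"
  using assms irreducible_imp_prime_on_mpolys[of UNIV p]
  by (intro prime_elemI) (auto simp: irreducible_def)

section \<open>Linear algebra of finite-dimensional subspaces\<close>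

text \<open>Carried along explicitly because \<open>dim\<close> is 0 when a basis is infinite, so
  monotonicity and rank-nullity would fail without it.\<close>

definition finite_dim :: "('a::field \<Rightarrow> 'b::ab_group_add \<Rightarrow> 'b) \<Rightarrow> 'b set \<Rightarrow> bool" where
  "finite_dim scl V \<longleftrightarrow> (\<exists>B. finite B \<and> V \<subseteq> module.span scl B)"

context vector_space
begin

lemma finite_dim_independent: "finite_dim scale V \<Longrightarrow> B \<subseteq> V \<Longrightarrow> independent B \<Longrightarrow> finite B"
  unfolding finite_dim_def using independent_span_bound by blast

lemma finite_dim_dim_mono:
  assumes "finite_dim scale W" "V \<subseteq> W"
  shows "dim V \<le> dim W"
proof -
  obtain C where C: "C \<subseteq> V" "independent C" "V \<subseteq> span C" "card C = dim V" by (rule basis_exists)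
  obtain D where D: "D \<subseteq> W" "independent D" "W \<subseteq> span D" "card D = dim W" by (rule basis_exists)
  have "finite D" using assms D finite_dim_independent by blast
  moreover have "C \<subseteq> span D" using C D assms by blast
  ultimately have "card C \<le> card D" using independent_span_bound C(2) by blast
  with C D show ?thesis by simp
qed

text \<open>Extends by linearity the map that kills the basis vectors in \<open>C\<close> and fixes
  the others. It separates the components of a vector with respect to the two parts of the
  basis.\<close>

lemma independent_separating_projection:
  assumes "independent D" "C \<subseteq> D"
  obtains \<pi> where "Vector_Spaces.linear scale scale \<pi>" "\<And>x. x \<in> span C \<Longrightarrow> \<pi> x = 0" "\<And>x. x \<in> span (D - C) \<Longrightarrow> \<pi> x = x"
proof -
  interpret P: vector_space_pair scale scale ..
  obtain \<pi> where \<pi>: "Vector_Spaces.linear scale scale \<pi>" "\<forall>x\<in>D. \<pi> x = (if x \<in> C then 0 else x)"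
    using P.linear_independent_extend[OF assms(1), of "\<lambda>x. if x \<in> C then 0 else x"] by auto
  show thesis
  proof
    show "Vector_Spaces.linear scale scale \<pi>" by fact
    show "\<pi> x = 0" if "x \<in> span C" for x
      by (rule P.linear_eq_0_on_span[OF \<pi>(1) _ that]) (use \<pi>(2) assms(2) in auto)
    show "\<pi> x = x" if "x \<in> span (D - C)" for x
      by (rule P.linear_eq_on[OF \<pi>(1) linear_ident that]) (use \<pi>(2) in auto)
  qed
qed

text \<open>A substitute for the quotient by \<open>W\<close>: projection onto a complement, so that
  no quotient type is needed.\<close>

lemma exists_linear_with_kernel:
  assumes "subspace W"
  obtains \<pi> where "Vector_Spaces.linear scale scale \<pi>" "\<And>x. \<pi> x = 0 \<longleftrightarrow> x \<in> W"
proof -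
  obtain C where C: "C \<subseteq> W" "independent C" "W \<subseteq> span C" by (rule basis_exists[of W])
  then have W: "W = span C" using span_minimal[OF _ assms] by (intro subset_antisym)
  obtain D where D: "C \<subseteq> D" "independent D" "UNIV \<subseteq> span D"
    by (rule maximal_independent_subset_extend[OF subset_UNIV C(2)])
  obtain \<pi> where \<pi>: "Vector_Spaces.linear scale scale \<pi>" "\<And>x. x \<in> span C \<Longrightarrow> \<pi> x = 0" "\<And>x. x \<in> span (D - C) \<Longrightarrow> \<pi> x = x"
    by (rule independent_separating_projection[OF D(2,1)]) blast
  interpret \<pi>: Vector_Spaces.linear scale scale \<pi> by fact
  have "x \<in> W" if "\<pi> x = 0" for x
  proof -
    have "x \<in> span (C \<union> (D - C))" using subsetD[OF D(3) UNIV_I] D(1) by (simp add: Un_absorb1)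
    then obtain u v where uv: "x = u + v" "u \<in> span C" "v \<in> span (D - C)"
      unfolding span_Un by blast
    with \<pi> that have "v = 0" by (simp add: \<pi>.add)
    with uv W show ?thesis by simp
  qed
  with \<pi> W that show thesis by blast
qed

text \<open>Here \<open>co l\<close> is the coefficient at index \<open>l\<close> and
  \<open>lm\<close> the leading index. One vector per occurring leading index gives a basis: the
  largest index in a relation shows independence, and successive cancellation of leading
  coefficients shows spanning.\<close>

lemma dim_eq_card_leading:
  fixes co :: "'o::linorder \<Rightarrow> 'b \<Rightarrow> 'a" and lm :: "'b \<Rightarrow> 'o"
  assumes V: "subspace V"
    and add: "\<And>l x y. co l (x + y) = co l x + co l y"
    and scl: "\<And>l c x. co l (scale c x) = c * co l x"
    and lm: "\<And>v. v \<in> V \<Longrightarrow> v \<noteq> 0 \<Longrightarrow> co (lm v) v \<noteq> 0"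
    and lm_gt: "\<And>v l. v \<in> V \<Longrightarrow> v \<noteq> 0 \<Longrightarrow> lm v < l \<Longrightarrow> co l v = 0"
    and fin: "finite (lm ` (V - {0}))"
  shows "dim V = card (lm ` (V - {0}))" and "finite_dim scale V"
proof -
  define L where "L = lm ` (V - {0})"
  have zero: "co l 0 = 0" for l using scl[of l 0 0] by simp
  have sum: "co l (sum g A) = (\<Sum>x\<in>A. co l (g x))" for l A and g :: "'o \<Rightarrow> 'b"
    by (induction A rule: infinite_finite_induct) (simp_all add: zero add)
  obtain w where w: "\<And>l. l \<in> L \<Longrightarrow> w l \<in> V \<and> w l \<noteq> 0 \<and> lm (w l) = l"
  proof -
    have "\<forall>l\<in>L. \<exists>v. v \<in> V \<and> v \<noteq> 0 \<and> lm v = l" by (auto simp: L_def)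
    then show thesis using that by (metis (full_types))
  qed
  have inj: "inj_on w L" using w by (metis inj_onI)
  have finL: "finite L" using fin by (simp add: L_def)
  have indep: "independent (w ` L)"
  proof (rule independent_if_scalars_zero)
    show "finite (w ` L)" using finL by simp
    fix f x assume sum0: "(\<Sum>x\<in>w ` L. scale (f x) x) = 0" and x: "x \<in> w ` L"
    show "f x = 0"
    proof (rule ccontr)
      assume "f x \<noteq> 0"
      define M where "M = {l\<in>L. f (w l) \<noteq> 0}"
      have "M \<noteq> {}" "finite M" using x \<open>f x \<noteq> 0\<close> finL by (auto simp: M_def)
      then have Max: "Max M \<in> M" "\<And>l. l \<in> M \<Longrightarrow> l \<le> Max M" by auto
      then have max_L: "Max M \<in> L" by (auto simp: M_def)
      have "0 = co (Max M) (\<Sum>x\<in>w ` L. scale (f x) x)" by (simp add: sum0 zero)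
      also have "\<dots> = (\<Sum>l\<in>L. f (w l) * co (Max M) (w l))"
        by (simp add: sum scl sum.reindex[OF inj])
      also have "\<dots> = (\<Sum>l\<in>{Max M}. f (w l) * co (Max M) (w l))"
      proof (rule sum.mono_neutral_right[OF finL])
        show "\<forall>l\<in>L - {Max M}. f (w l) * co (Max M) (w l) = 0"
        proof
          fix l assume l: "l \<in> L - {Max M}"
          show "f (w l) * co (Max M) (w l) = 0"
          proof (cases "f (w l) = 0")
            case False
            with l Max(2)[of l] have "l < Max M" by (auto simp: M_def)
            then show ?thesis using lm_gt[of "w l" "Max M"] w[of l] l by auto
          qed simp
        qed
      qed (use max_L in auto)
      also have "\<dots> = f (w (Max M)) * co (Max M) (w (Max M))" by simp
      also have "\<dots> \<noteq> 0" using Max(1) lm[of "w (Max M)"] w[OF max_L] by (auto simp: M_def)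
      finally show False by simp
    qed
  qed
  have span: "v \<in> span (w ` L)" if "v \<in> V" for v
    using that
  \<comment> \<open>The order on indices need not be well-founded. As \<open>L\<close> is finite,
    the number of possible leading indices up to that of \<open>v\<close> serves as the measure,
    with 0 for the zero vector.\<close>
  proof (induction "card {l\<in>L. v \<noteq> 0 \<and> l \<le> lm v}" arbitrary: v rule: less_induct)
    case less
    show ?case
    proof (cases "v = 0")
      case True
      then show ?thesis by (simp add: span_zero)
    next
      case False
      define l where "l = lm v"
      have l: "l \<in> L" using False less.prems by (auto simp: L_def l_def)
      note wl = w[OF l]
      define c where "c = co l v / co l (w l)"
      define v' where "v' = v - scale c (w l)"
      have v'V: "v' \<in> V" unfolding v'_def using less.prems wl V by (simp add: subspace_diff subspace_scale)
      have vv': "v = v' + scale c (w l)" by (simp add: v'_def)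
      have cv': "co k v' = co k v - c * co k (w l)" for k
        using add[of k v' "scale c (w l)"] scl by (simp add: vv'[symmetric])
      have "v' = 0 \<or> lm v' < l"
      proof (rule ccontr)
        assume *: "\<not> (v' = 0 \<or> lm v' < l)"
        then have nz: "co (lm v') v' \<noteq> 0" using lm v'V by simp
        show False
        proof (cases "lm v' = l")
          case True
          with nz cv'[of l] lm[of "w l"] wl show False by (simp add: c_def)
        next
          case False
          with * have "l < lm v'" by (metis linorder_cases)
          then have "co (lm v') v = 0" "co (lm v') (w l) = 0"
            using lm_gt[of v "lm v'"] lm_gt[of "w l" "lm v'"] wl less.prems \<open>v \<noteq> 0\<close> by (auto simp: l_def)
          with nz cv' show False by simp
        qed
      qed
      then have "{k\<in>L. v' \<noteq> 0 \<and> k \<le> lm v'} \<subset> {k\<in>L. v \<noteq> 0 \<and> k \<le> lm v}"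
      proof (intro psubsetI)
        show "{k\<in>L. v' \<noteq> 0 \<and> k \<le> lm v'} \<noteq> {k\<in>L. v \<noteq> 0 \<and> k \<le> lm v}"
        proof
          assume "{k\<in>L. v' \<noteq> 0 \<and> k \<le> lm v'} = {k\<in>L. v \<noteq> 0 \<and> k \<le> lm v}"
          moreover have "l \<in> {k\<in>L. v \<noteq> 0 \<and> k \<le> lm v}" using l False by (simp add: l_def)
          ultimately have "v' \<noteq> 0 \<and> l \<le> lm v'" by blast
          with \<open>v' = 0 \<or> lm v' < l\<close> show False by auto
        qed
      qed (use False in \<open>auto simp: l_def\<close>)
      then have "card {k\<in>L. v' \<noteq> 0 \<and> k \<le> lm v'} < card {k\<in>L. v \<noteq> 0 \<and> k \<le> lm v}"
        using finL by (intro psubset_card_mono) auto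
      from less.hyps[OF this v'V] have "v' \<in> span (w ` L)" .
      moreover have "scale c (w l) \<in> span (w ` L)" using l by (intro span_scale span_base) auto
      ultimately show ?thesis unfolding vv' by (rule span_add)
    qed
  qed
  have "card (w ` L) = dim V"
    using w span indep by (intro basis_card_eq_dim) auto
  then show "dim V = card (lm ` (V - {0}))"
    using inj by (simp add: card_image L_def)
  show "finite_dim scale V" unfolding finite_dim_def using finL span by (intro exI[of _ "w ` L"]) auto
qed

end

context vector_space_pair
begin

lemma finite_dim_image:
  assumes "Vector_Spaces.linear s1 s2 f" "finite_dim s1 V"
  shows "finite_dim s2 (f ` V)"
proof -
  from assms(2) obtain B where B: "finite B" "V \<subseteq> vs1.span B" by (auto simp: finite_dim_def)
  then have "f ` V \<subseteq> vs2.span (f ` B)" using linear_span_image[OF assms(1)] by blast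
  with B show ?thesis unfolding finite_dim_def by blast
qed

text \<open>A basis \<open>C\<close> of the kernel is extended to a basis \<open>D\<close> of
  \<open>V\<close>; \<open>f\<close> is injective on the span of \<open>D - C\<close>, whose basis
  therefore maps to a basis of the image.\<close>

lemma rank_nullity:
  assumes f: "Vector_Spaces.linear s1 s2 f" and V: "vs1.subspace V" "finite_dim s1 V"
  shows "vs1.dim V = vs1.dim {v\<in>V. f v = 0} + vs2.dim (f ` V)"
proof -
  interpret f: Vector_Spaces.linear s1 s2 f by fact
  define K where "K = {v\<in>V. f v = 0}"
  obtain C where C: "C \<subseteq> K" "vs1.independent C" "K \<subseteq> vs1.span C" "card C = vs1.dim K"
    by (rule vs1.basis_exists)
  have "C \<subseteq> V" using C by (auto simp: K_def)
  then obtain D where D: "C \<subseteq> D" "D \<subseteq> V" "vs1.independent D" "V \<subseteq> vs1.span D"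
    using vs1.maximal_independent_subset_extend[of C V] C by blast
  have finD: "finite D" using vs1.finite_dim_independent V D by blast
  have cardD: "card D = vs1.dim V" using D by (intro vs1.basis_card_eq_dim) auto
  obtain \<pi> where \<pi>: "Vector_Spaces.linear s1 s1 \<pi>" "\<And>x. x \<in> vs1.span C \<Longrightarrow> \<pi> x = 0"
    "\<And>x. x \<in> vs1.span (D - C) \<Longrightarrow> \<pi> x = x"
    by (rule vs1.independent_separating_projection[OF D(3,1)]) blast
  have inj: "inj_on f (vs1.span (D - C))"
  proof -
    have "x = 0" if "x \<in> vs1.span (D - C)" "f x = 0" for x
    proof -
      have "x \<in> V" using that(1) vs1.span_minimal[OF _ V(1), of "D - C"] D by auto
      with that have "x \<in> vs1.span C" using C by (auto simp: K_def)
      with \<pi> that show ?thesis by metis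
    qed
    then show ?thesis by (subst f.inj_on_iff_eq_0) (auto simp: vs1.subspace_span)
  qed
  have ind: "vs2.independent (f ` (D - C))"
    using f.independent_injective_image[OF _ inj] vs1.independent_mono[OF D(3)] by blast
  have "f ` V \<subseteq> vs2.span (f ` (D - C))"
  proof
    fix y assume "y \<in> f ` V"
    then obtain x where x: "x \<in> V" "y = f x" by blast
    then have "x \<in> vs1.span (C \<union> (D - C))" using D by (auto simp: Un_absorb1)
    then obtain u v where uv: "x = u + v" "u \<in> vs1.span C" "v \<in> vs1.span (D - C)"
      unfolding vs1.span_Un by blast
    have "f u = 0" by (rule f.eq_0_on_span[OF _ uv(2)]) (use C in \<open>auto simp: K_def\<close>)
    then show "y \<in> vs2.span (f ` (D - C))" using x uv by (auto simp: f.add f.span_image)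
  qed
  moreover have "f ` (D - C) \<subseteq> f ` V" using D by auto
  ultimately have "card (f ` (D - C)) = vs2.dim (f ` V)"
    using ind by (intro vs2.basis_card_eq_dim) auto
  moreover have "card (f ` (D - C)) = card (D - C)"
    using inj by (intro card_image) (rule inj_on_subset, auto intro: vs1.span_base)
  moreover have "card (D - C) + card C = card D"
    using finD D(1) by (simp add: card_Diff_subset finite_subset card_mono)
  ultimately show ?thesis using C cardD by (simp add: K_def)
qed

lemma dim_image_inj_on:
  assumes "Vector_Spaces.linear s1 s2 f" "vs1.subspace V" "finite_dim s1 V"
    and inj: "\<And>v. v \<in> V \<Longrightarrow> f v = 0 \<Longrightarrow> v = 0"
  shows "vs2.dim (f ` V) = vs1.dim V"
proof -
  interpret f: Vector_Spaces.linear s1 s2 f by fact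
  have "{v\<in>V. f v = 0} = vs1.span {}"
    using inj assms(2) by (auto simp: vs1.subspace_0 f.zero)
  then have "vs1.dim {v\<in>V. f v = 0} = 0"
    using vs1.dim_span_eq_card_independent[OF vs1.independent_empty] by simp
  with rank_nullity[OF assms(1-3)] show ?thesis by simp
qed

end

section \<open>Hilbert series of monomial ideals\<close>

lemma finite_mdeg_le: "finite {m :: 'v::finite \<Rightarrow>\<^sub>0 nat. mdeg m \<le> j}"
proof -
  have "lookup ` {m :: 'v \<Rightarrow>\<^sub>0 nat. mdeg m \<le> j} \<subseteq> {f. \<forall>i. (i \<in> UNIV \<longrightarrow> f i \<in> {..j}) \<and> (i \<notin> UNIV \<longrightarrow> f i = 0)}"
  proof clarsimp
    fix m :: "'v \<Rightarrow>\<^sub>0 nat" and i assume "mdeg m \<le> j"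
    moreover have "lookup m i \<le> mdeg m" unfolding mdeg_eq_sum by (rule member_le_sum) auto
    ultimately show "lookup m i \<le> j" by simp
  qed
  moreover have "finite {f :: 'v \<Rightarrow> nat. \<forall>i. (i \<in> UNIV \<longrightarrow> f i \<in> {..j}) \<and> (i \<notin> UNIV \<longrightarrow> f i = 0)}"
    by (rule finite_set_of_finite_funs) auto
  ultimately have "finite (lookup ` {m :: 'v \<Rightarrow>\<^sub>0 nat. mdeg m \<le> j})"
    by (rule finite_subset)
  then show ?thesis
    by (rule finite_imageD) (auto intro!: inj_onI poly_mapping_eqI)
qed

definition mono_series :: "'v set \<Rightarrow> ('v \<Rightarrow>\<^sub>0 nat) set \<Rightarrow> int fps" where
  "mono_series A U = Abs_fps (\<lambda>j. int (card {m\<in>U. keys m \<subseteq> A \<and> mdeg m = j}))"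

text \<open>For \<open>A = UNIV\<close> these are the exponent sets of monomial ideals. Members of
  \<open>U\<close> may involve variables outside \<open>A\<close>, so that \<open>U\<close> need not
  be changed when \<open>A\<close> shrinks.\<close>

definition upclosed :: "'v set \<Rightarrow> ('v \<Rightarrow>\<^sub>0 nat) set \<Rightarrow> bool" where
  "upclosed A U \<longleftrightarrow> (\<forall>m\<in>U. \<forall>s. keys s \<subseteq> A \<longrightarrow> m + s \<in> U)"

text \<open>The colon ideal (U : x^k), in terms of exponents.\<close>

definition slice :: "'v \<Rightarrow> nat \<Rightarrow> ('v \<Rightarrow>\<^sub>0 nat) set \<Rightarrow> ('v \<Rightarrow>\<^sub>0 nat) set" where
  "slice x k U = {m. m + single x k \<in> U}"

lemma upclosed_mono: "upclosed B U \<Longrightarrow> A \<subseteq> B \<Longrightarrow> upclosed A U"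
  unfolding upclosed_def by blast

lemma upclosed_slice: "upclosed A U \<Longrightarrow> upclosed A (slice x k U)"
  unfolding upclosed_def slice_def by (simp add: add.assoc add.commute[of _ "single x k"]) (simp flip: add.assoc)

lemma slice_slice: "slice x k (slice x l U) = slice x (k + l) U"
  by (simp add: slice_def add.assoc flip: single_add)

lemma slice_zero [simp]: "slice x 0 U = U"
  by (simp add: slice_def)

lemma slice_mono: "U \<subseteq> V \<Longrightarrow> slice x k U \<subseteq> slice x k V"
  by (auto simp: slice_def)

lemma slice_increasing:
  assumes "upclosed A U" "x \<in> A" "k \<le> l"
  shows "slice x k U \<subseteq> slice x l U"
proof
  fix m assume "m \<in> slice x k U"
  then have "m + single x k + single x (l - k) \<in> U"
    using assms by (auto simp: slice_def upclosed_def)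
  then show "m \<in> slice x l U"
    using assms(3) by (simp add: slice_def add.assoc flip: single_add)
qed

text \<open>Dickson's lemma. In the induction step the diagonal slices stabilise at some \<open>L\<close>, which
  takes care of all slices beyond \<open>L\<close>; the finitely many remaining ones stabilise separately.\<close>

lemma upclosed_chain_stabilises:
  fixes U :: "nat \<Rightarrow> ('v \<Rightarrow>\<^sub>0 nat) set"
  assumes "finite A" "\<And>l. upclosed A (U l)" "\<And>k l. k \<le> l \<Longrightarrow> U k \<subseteq> U l"
  shows "\<exists>L. \<forall>l\<ge>L. \<forall>m. keys m \<subseteq> A \<longrightarrow> m \<in> U l \<longrightarrow> m \<in> U L"
  using assms
proof (induction A arbitrary: U rule: finite_induct)
  case empty
  show ?case
  proof (cases "\<exists>L. 0 \<in> U L")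
    case True
    then show ?thesis by auto
  next
    case False
    then show ?thesis by auto
  qed
next
  case (insert x A)
  have up: "upclosed A (slice x k (U l))" for k l
    using insert.prems(1) by (intro upclosed_slice upclosed_mono[of "insert x A" _ A]) auto
  have mono: "slice x k (U l) \<subseteq> slice x k' (U l')" if "k \<le> k'" "l \<le> l'" for k k' l l'
  proof -
    have "slice x k (U l) \<subseteq> slice x k' (U l)"
      using slice_increasing[OF insert.prems(1) _ that(1)] by simp
    also have "\<dots> \<subseteq> slice x k' (U l')" using insert.prems(2)[OF that(2)] by (rule slice_mono)
    finally show ?thesis .
  qed
  obtain L where L: "\<And>l m. l \<ge> L \<Longrightarrow> keys m \<subseteq> A \<Longrightarrow> m \<in> slice x l (U l) \<Longrightarrow> m \<in> slice x L (U L)"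
    using insert.IH[of "\<lambda>l. slice x l (U l)"] up mono by blast
  have "\<forall>k. \<exists>N. \<forall>l\<ge>N. \<forall>m. keys m \<subseteq> A \<longrightarrow> m \<in> slice x k (U l) \<longrightarrow> m \<in> slice x k (U N)"
    using insert.IH[of "\<lambda>l. slice x _ (U l)"] up mono by blast
  then obtain N where N: "\<And>k l m. l \<ge> N k \<Longrightarrow> keys m \<subseteq> A \<Longrightarrow> m \<in> slice x k (U l) \<Longrightarrow> m \<in> slice x k (U (N k))"
    by metis
  define M where "M = Max (insert L (N ` {..<L}))"
  have "L \<le> M" unfolding M_def by (rule Max_ge) auto
  have NM: "N k \<le> M" if "k < L" for k unfolding M_def using that by (intro Max_ge) auto
  show ?case
  proof (intro exI[of _ M] allI impI)
    fix l m assume l: "M \<le> l" and m: "keys m \<subseteq> insert x A" "m \<in> U l"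
    define k n where "k = lookup m x" and "n = m - single x k"
    have n: "m = n + single x k" "lookup n x = 0"
      using split_off_var[of m x n k] by (auto simp: k_def n_def)
    have nA: "keys n \<subseteq> A"
    proof
      fix y assume "y \<in> keys n"
      moreover from this have "y \<in> keys m" by (simp add: n(1) in_keys_iff lookup_add)
      moreover from \<open>y \<in> keys n\<close> n have "y \<noteq> x" by (auto simp: in_keys_iff)
      ultimately show "y \<in> A" using m(1) by blast
    qed
    have "n \<in> slice x k (U l)" using m n by (simp add: slice_def)
    have "n \<in> slice x k (U M)"
    proof (cases "k < L")
      case True
      then have "n \<in> slice x k (U (N k))" using N[of k l n] l NM \<open>n \<in> slice x k (U l)\<close> nA by fastforce
      then show ?thesis using mono[of k k "N k" M] NM True by auto
    next
      case False
      \<comment> \<open>Raising both indices to their maximum moves to the diagonal, where stability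
        beyond \<open>L\<close> is known.\<close>
      have "n \<in> slice x (max k l) (U (max k l))" using mono[of k "max k l" l "max k l"] \<open>n \<in> slice x k (U l)\<close> by auto
      then have "n \<in> slice x L (U L)" using L[of "max k l" n] nA False by auto
      then show ?thesis using mono[of L k L M] False \<open>L \<le> M\<close> by auto
    qed
    then show "m \<in> U M" using n by (simp add: slice_def)
  qed
qed

text \<open>Monomials of \<open>U\<close> not divisible by \<open>x\<close> are counted over
  \<open>A\<close>; the others are \<open>x\<close> times a monomial of the colon ideal, one degree
  lower.\<close>

lemma mono_series_insert:
  fixes U :: "('v::finite \<Rightarrow>\<^sub>0 nat) set"
  assumes "x \<notin> A"
  shows "mono_series (insert x A) U = mono_series A U + fps_X * mono_series (insert x A) (slice x 1 U)"
proof (rule fps_ext)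
  fix j
  define P where "P = {m\<in>U. keys m \<subseteq> insert x A \<and> mdeg m = j}"
  define Q where "Q = {m\<in>U. keys m \<subseteq> A \<and> mdeg m = j}"
  define R where "R = {m\<in>slice x 1 U. keys m \<subseteq> insert x A \<and> Suc (mdeg m) = j}"
  have "P = Q \<union> (\<lambda>m. m + single x 1) ` R"
  proof (intro equalityI subsetI)
    fix m assume m: "m \<in> P"
    show "m \<in> Q \<union> (\<lambda>m. m + single x 1) ` R"
    proof (cases "lookup m x = 0")
      case True
      then have "x \<notin> keys m" by (simp add: in_keys_iff)
      with m show ?thesis by (auto simp: P_def Q_def)
    next
      case False
      define n where "n = m - single x 1"
      have n: "m = n + single x 1"
        using False by (intro poly_mapping_eqI) (auto simp: n_def lookup_add lookup_minus lookup_single when_def)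
      have "keys n \<subseteq> keys m" by (auto simp: n in_keys_iff lookup_add)
      with m n have "n \<in> R" by (auto simp: P_def R_def slice_def)
      with n show ?thesis by auto
    qed
  next
    fix m assume "m \<in> Q \<union> (\<lambda>m. m + single x 1) ` R"
    then show "m \<in> P"
    proof
      assume "m \<in> (\<lambda>m. m + single x 1) ` R"
      then obtain n where n: "n \<in> R" "m = n + single x 1" by blast
      have "keys m \<subseteq> insert x (keys n)" using keys_add[of n "single x 1"] by (auto simp: n)
      with n show ?thesis by (auto simp: P_def R_def slice_def)
    qed (auto simp: P_def Q_def)
  qed
  moreover have "Q \<inter> (\<lambda>m. m + single x 1) ` R = {}"
    using assms by (auto simp: Q_def in_keys_iff lookup_add subset_iff)
  moreover have "finite P" unfolding P_def by (rule finite_subset[OF _ finite_mdeg_le[of j]]) auto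
  ultimately have "card P = card Q + card ((\<lambda>m. m + single x 1) ` R)"
    by (metis card_Un_disjoint finite_Un)
  also have "card ((\<lambda>m. m + single x 1) ` R) = card R"
    by (rule card_image) (auto intro: inj_onI)
  finally have "card P = card Q + card R" .
  moreover have "j = 0 \<Longrightarrow> card R = 0" by (simp add: R_def)
  moreover have "j > 0 \<Longrightarrow> R = {m\<in>slice x 1 U. keys m \<subseteq> insert x A \<and> mdeg m = j - 1}"
    by (auto simp: R_def)
  ultimately show "fps_nth (mono_series (insert x A) U) j =
      fps_nth (mono_series A U + fps_X * mono_series (insert x A) (slice x 1 U)) j"
    by (cases "j = 0") (simp_all add: mono_series_def P_def Q_def)
qed

lemma mono_series_cong:
  "(\<And>m. keys m \<subseteq> A \<Longrightarrow> m \<in> U \<longleftrightarrow> m \<in> V) \<Longrightarrow> mono_series A U = mono_series A V"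
  unfolding mono_series_def by (metis (mono_tags, lifting) Collect_cong)

text \<open>If dividing by \<open>x\<close> does not enlarge \<open>U\<close>, the recursion refers
  to the same series, and one factor 1-t removes the variable.\<close>

lemma mono_series_insert_stable:
  fixes U :: "('v::finite \<Rightarrow>\<^sub>0 nat) set"
  assumes "x \<notin> A" "\<And>m. keys m \<subseteq> insert x A \<Longrightarrow> m \<in> slice x 1 U \<longleftrightarrow> m \<in> U"
  shows "(1 - fps_X) * mono_series (insert x A) U = mono_series A U"
  using mono_series_insert[OF assms(1), of U] mono_series_cong[of "insert x A" "slice x 1 U" U] assms(2)
  by (simp add: algebra_simps)

lemma mono_series_empty: "mono_series {} U = (if 0 \<in> U then 1 else 0)"
proof (rule fps_ext)
  fix j
  have "{m\<in>U. keys m \<subseteq> {} \<and> mdeg m = j} = (if 0 \<in> U \<and> j = 0 then {0} else {})" by auto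
  then show "fps_nth (mono_series {} U) j = fps_nth (if 0 \<in> U then 1 else 0) j"
    by (simp add: mono_series_def)
qed

lemma mono_series_UNIV:
  "finite A \<Longrightarrow> (1 - fps_X) ^ card A * mono_series A (UNIV :: ('v::finite \<Rightarrow>\<^sub>0 nat) set) = 1"
proof (induction A rule: finite_induct)
  case empty
  then show ?case by (simp add: mono_series_empty)
next
  case (insert x A)
  have "(1 - fps_X) * mono_series (insert x A) (UNIV :: ('v \<Rightarrow>\<^sub>0 nat) set) = mono_series A UNIV"
    by (rule mono_series_insert_stable[OF insert.hyps(2)]) (simp add: slice_def)
  with insert show ?case by (simp add: mult.assoc power_Suc2 del: power_Suc)
qed

text \<open>The colon ideals by powers of \<open>x\<close> become stationary at some exponent
  \<open>K\<close>. There one factor 1-t reduces to fewer variables, and the recursion for one extra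
  variable leads from exponent \<open>K\<close> back to 0.\<close>

lemma Hilbert_Serre_monomial:
  fixes U :: "('v::finite \<Rightarrow>\<^sub>0 nat) set"
  assumes "finite A" "upclosed A U"
  shows "\<exists>p :: int poly. fps_of_poly p = (1 - fps_X) ^ card A * mono_series A U"
  using assms
proof (induction A arbitrary: U rule: finite_induct)
  case empty
  show ?case by (intro exI[of _ "if 0 \<in> U then 1 else 0"]) (simp add: mono_series_empty)
next
  case (insert x A)
  define P where "P U \<longleftrightarrow> (\<exists>p :: int poly. fps_of_poly p = (1 - fps_X) ^ card (insert x A) * mono_series (insert x A) U)"
    for U :: "('v \<Rightarrow>\<^sub>0 nat) set"
  have upA: "upclosed A (slice x k U)" and up: "upclosed (insert x A) (slice x k U)" for k
    using insert.prems by (auto intro: upclosed_slice upclosed_mono)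
  have inc: "slice x k U \<subseteq> slice x l U" if "k \<le> l" for k l
    using slice_increasing[OF insert.prems _ that] by simp
  obtain K where K: "\<And>l m. l \<ge> K \<Longrightarrow> keys m \<subseteq> insert x A \<Longrightarrow> m \<in> slice x l U \<Longrightarrow> m \<in> slice x K U"
    using upclosed_chain_stabilises[of "insert x A" "\<lambda>k. slice x k U"] insert.hyps up inc by blast
  \<comment> \<open>Descending induction from the stable exponent; once \<open>k\<close> reaches
    \<open>K\<close>, truncated subtraction keeps the slice at exponent 0.\<close>
  have "P (slice x (K - k) U)" for k
  proof (induction k)
    case 0
    have "(1 - fps_X) * mono_series (insert x A) (slice x K U) = mono_series A (slice x K U)"
    proof (rule mono_series_insert_stable[OF insert.hyps(2)])
      fix m :: "'v \<Rightarrow>\<^sub>0 nat" assume "keys m \<subseteq> insert x A"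
      then show "m \<in> slice x 1 (slice x K U) \<longleftrightarrow> m \<in> slice x K U"
        unfolding slice_slice using K[of "1 + K" m] inc[of K "1 + K"] by auto
    qed
    then have "(1 - fps_X) ^ card (insert x A) * mono_series (insert x A) (slice x K U) =
        (1 - fps_X) ^ card A * mono_series A (slice x K U)"
      using insert.hyps by (simp add: mult.assoc power_Suc2 del: power_Suc)
    with insert.IH[OF upA, of K] show ?case unfolding P_def by simp
  next
    case (Suc k)
    show ?case
    proof (cases "k < K")
      case True
      then have *: "slice x 1 (slice x (K - Suc k) U) = slice x (K - k) U"
        by (simp add: slice_slice Suc_diff_Suc)
      obtain p :: "int poly" where p: "fps_of_poly p = (1 - fps_X) ^ card A * mono_series A (slice x (K - Suc k) U)"
        using insert.IH[OF upA, of "K - Suc k"] by blast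
      obtain q :: "int poly" where q: "fps_of_poly q = (1 - fps_X) ^ card (insert x A) * mono_series (insert x A) (slice x (K - k) U)"
        using Suc.IH unfolding P_def by blast
      have rec: "mono_series (insert x A) (slice x (K - Suc k) U) =
          mono_series A (slice x (K - Suc k) U) + fps_X * mono_series (insert x A) (slice x (K - k) U)"
        using mono_series_insert[OF insert.hyps(2), of "slice x (K - Suc k) U"] by (simp only: *)
      have lin: "fps_of_poly [:1, -1:] = (1 - fps_X :: int fps)" "fps_of_poly [:0, 1:] = (fps_X :: int fps)"
        by (simp_all add: fps_of_poly_pCons fps_const_neg[symmetric] del: fps_const_neg)
      have "fps_of_poly ([:1, -1:] * p + [:0, 1:] * q) =
          (1 - fps_X) ^ card (insert x A) * mono_series (insert x A) (slice x (K - Suc k) U)"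
        unfolding fps_of_poly_add fps_of_poly_mult lin p q rec using insert.hyps
        by (simp add: distrib_left mult.assoc mult.left_commute)
      then show ?thesis unfolding P_def by blast
    next
      case False
      with Suc show ?thesis by simp
    qed
  qed
  from this[of K] show ?case by (simp add: P_def)
qed

section \<open>Filtered submodules and their leading terms\<close>

definition pscale :: "'k \<Rightarrow> ('u, 'k::comm_semiring_1) mpoly \<Rightarrow> ('u, 'k) mpoly" where
  "pscale c p = mconst c * p"

lemma mconst_add: "mconst (a + b) = mconst a + mconst b"
  by (simp add: mconst_def single_add)

interpretation PV: vector_space "pscale :: 'k::field \<Rightarrow> ('u, 'k) mpoly \<Rightarrow> _"
  by unfold_locales (simp_all add: pscale_def mconst_add mconst_one mconst_mult algebra_simps flip: mult.assoc)

interpretation KV: vector_space "kscale :: 'k::field \<Rightarrow> ('w \<Rightarrow> ('u, 'k) mpoly) \<Rightarrow> _"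
  by unfold_locales
    (simp_all add: kscale_def mconst_add mconst_one mconst_mult algebra_simps fun_eq_iff flip: mult.assoc)

interpretation KP: vector_space_pair "kscale :: 'k::field \<Rightarrow> ('w \<Rightarrow> ('u, 'k) mpoly) \<Rightarrow> _"
  "pscale :: 'k \<Rightarrow> ('u, 'k) mpoly \<Rightarrow> _" ..

interpretation PP: vector_space_pair "pscale :: 'k::field \<Rightarrow> ('u, 'k) mpoly \<Rightarrow> _"
  "pscale :: 'k \<Rightarrow> ('u, 'k) mpoly \<Rightarrow> _" ..

interpretation KK: vector_space_pair "kscale :: 'k::field \<Rightarrow> ('w \<Rightarrow> ('u, 'k) mpoly) \<Rightarrow> _"
  "kscale :: 'k \<Rightarrow> ('w \<Rightarrow> ('t, 'k) mpoly) \<Rightarrow> _" ..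

lemma kdim_eq: "kdim = KV.dim"
  by (simp add: kdim_def fun_eq_iff)

definition mpoly_le :: "nat \<Rightarrow> ('u, 'k::zero) mpoly set" where
  "mpoly_le j = {p. tdeg p \<le> j}"

definition vec_le :: "nat \<Rightarrow> ('w \<Rightarrow> ('u, 'k::zero) mpoly) set" where
  "vec_le j = {v. \<forall>i. tdeg (v i) \<le> j}"

definition num_mons :: "'v itself \<Rightarrow> nat \<Rightarrow> nat" where
  "num_mons _ j = card {m :: 'v \<Rightarrow>\<^sub>0 nat. mdeg m \<le> j}"

lemma subspace_mpoly_le: "PV.subspace (mpoly_le j :: ('v::finite, 'k::field) mpoly set)"
  unfolding PV.subspace_def mpoly_le_def pscale_def
  by (auto intro: tdeg_add_le order_trans[OF tdeg_mconst_mult_le])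

lemma subspace_vec_le: "KV.subspace (vec_le j :: ('w \<Rightarrow> ('v::finite, 'k::field) mpoly) set)"
  unfolding KV.subspace_def vec_le_def kscale_def
  by (auto intro: tdeg_add_le order_trans[OF tdeg_mconst_mult_le])

lemma dim_mpoly_le:
  "PV.dim (mpoly_le j :: ('v::{finite,linorder}, 'k::field) mpoly set) = num_mons TYPE('v) j" (is ?dim)
  and finite_dim_mpoly_le: "finite_dim pscale (mpoly_le j :: ('v, 'k) mpoly set)" (is ?fin)
proof -
  define V where "V = (mpoly_le j :: ('v, 'k) mpoly set)"
  define lm :: "('v, 'k) mpoly \<Rightarrow> 'v \<Rightarrow>\<^sub>0 nat" where "lm p = Max (keys p)" for p
  have lm: "lm p \<in> keys p" "\<And>m. m \<in> keys p \<Longrightarrow> m \<le> lm p" if "p \<noteq> 0" for p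
    using that by (auto simp: lm_def)
  have img: "lm ` (V - {0}) = {m. mdeg m \<le> j}"
  proof (intro equalityI subsetI)
    fix m assume "m \<in> lm ` (V - {0})"
    then show "m \<in> {m. mdeg m \<le> j}"
      using lm(1) by (auto simp: V_def mpoly_le_def tdeg_le_iff)
  next
    fix m :: "'v \<Rightarrow>\<^sub>0 nat" assume "m \<in> {m. mdeg m \<le> j}"
    then have "single m 1 \<in> V - {0}"
      by (auto simp: V_def mpoly_le_def tdeg_le_iff) (metis lookup_single_eq lookup_zero zero_neq_one)
    moreover have "lm (single m 1) = m" by (simp add: lm_def)
    ultimately show "m \<in> lm ` (V - {0})" by (metis image_eqI)
  qed
  have fin: "finite (lm ` (V - {0}))" unfolding img by (rule finite_mdeg_le)
  have sub: "PV.subspace V" unfolding V_def by (rule subspace_mpoly_le)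
  have lm_gt: "lookup v m = 0" if "v \<in> V" "v \<noteq> 0" "lm v < m" for v m
    using lm(2)[of v m] that by (metis in_keys_iff leD)
  note * = PV.dim_eq_card_leading[of V "\<lambda>m p. lookup p m" lm, OF sub lookup_add _ _ lm_gt fin]
  show ?dim
    using * lm(1) by (simp add: pscale_def lookup_mconst_mult in_keys_iff V_def[symmetric] img num_mons_def)
  show ?fin
    using * lm(1) by (simp add: pscale_def lookup_mconst_mult in_keys_iff V_def[symmetric])
qed

text \<open>Comparing degrees first makes the leading term of a vector record its degree.\<close>

definition lead :: "('w::linorder \<Rightarrow> ('v::linorder, 'k::zero) mpoly) \<Rightarrow> nat \<times> ('v \<Rightarrow>\<^sub>0 nat) \<times> 'w" where
  "lead v = Max {(mdeg m, m, i) | m i. m \<in> keys (v i)}"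

lemma finite_terms: "finite {(mdeg m, m, i) | m i. m \<in> keys (v i)}"
  for v :: "'w::finite \<Rightarrow> ('v, 'k::zero) mpoly"
proof -
  have "{(mdeg m, m, i) | m i. m \<in> keys (v i)} = (\<Union>i. (\<lambda>m. (mdeg m, m, i)) ` keys (v i))" by auto
  then show ?thesis by simp
qed

lemma lead_in_terms:
  fixes v :: "'w::{finite,linorder} \<Rightarrow> ('v::linorder, 'k::zero) mpoly"
  assumes "v \<noteq> 0"
  shows "lead v \<in> {(mdeg m, m, i) | m i. m \<in> keys (v i)}"
proof -
  obtain i where "v i \<noteq> 0" using assms by (auto simp: fun_eq_iff)
  then obtain m where "m \<in> keys (v i)" by (metis keys_eq_empty ex_in_conv)
  then have "{(mdeg m, m, i) | m i. m \<in> keys (v i)} \<noteq> {}" by auto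
  with finite_terms[of v] show ?thesis unfolding lead_def by (rule Max_in)
qed

lemma lead_ge:
  fixes v :: "'w::{finite,linorder} \<Rightarrow> ('v::linorder, 'k::zero) mpoly"
  shows "m \<in> keys (v i) \<Longrightarrow> (mdeg m, m, i) \<le> lead v"
  unfolding lead_def by (rule Max_ge[OF finite_terms]) auto

lemma fst_lead_le_iff:
  fixes v :: "'w::{finite,linorder} \<Rightarrow> ('v::linorder, 'k::zero) mpoly"
  assumes "v \<noteq> 0"
  shows "fst (lead v) \<le> j \<longleftrightarrow> v \<in> vec_le j"
proof
  assume *: "fst (lead v) \<le> j"
  have "mdeg m \<le> j" if "m \<in> keys (v i)" for m i
    using lead_ge[where v = v and i = i, OF that] * by (cases "lead v") (auto simp: less_eq_prod_def)
  then show "v \<in> vec_le j" by (simp add: vec_le_def tdeg_le_iff)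
next
  assume "v \<in> vec_le j"
  with lead_in_terms[OF assms] show "fst (lead v) \<le> j" by (auto simp: vec_le_def tdeg_le_iff)
qed

text \<open>Since degrees are compared first, cutting \<open>V\<close> at degree \<open>j\<close>
  just cuts its set of leading terms at degree \<open>j\<close>. One set of leading terms thus gives
  all dimensions at once.\<close>

lemma kdim_eq_card_lead:
  fixes V :: "('w::{finite,linorder} \<Rightarrow> ('v::{finite,linorder}, 'k::field) mpoly) set"
  assumes V: "KV.subspace V"
  shows "kdim (V \<inter> vec_le j) = card {l \<in> lead ` (V - {0}). fst l \<le> j}" (is ?dim)
    and "finite_dim kscale (V \<inter> vec_le j)" (is ?fin)
proof -
  \<comment> \<open>Triples whose first entry is not the degree of the monomial denote no term and
    get coefficient 0.\<close>
  define co :: "nat \<times> ('v \<Rightarrow>\<^sub>0 nat) \<times> 'w \<Rightarrow> ('w \<Rightarrow> ('v, 'k) mpoly) \<Rightarrow> 'k" where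
    "co l v = (case l of (d, m, i) \<Rightarrow> if d = mdeg m then lookup (v i) m else 0)" for l v
  have img: "lead ` (V \<inter> vec_le j - {0}) = {l \<in> lead ` (V - {0}). fst l \<le> j}"
    using fst_lead_le_iff by (auto simp: image_iff) blast+
  have "{l \<in> lead ` (V - {0}). fst l \<le> j} \<subseteq> (\<lambda>(m, i). (mdeg m, m, i)) ` ({m. mdeg m \<le> j} \<times> UNIV)"
  proof
    fix l assume "l \<in> {l \<in> lead ` (V - {0}). fst l \<le> j}"
    then obtain v :: "'w \<Rightarrow> ('v, 'k) mpoly" where v: "v \<noteq> 0" "l = lead v" "fst l \<le> j" by blast
    with lead_in_terms[of v] obtain m i where "l = (mdeg m, m, i)" by auto
    with v(3) show "l \<in> (\<lambda>(m, i). (mdeg m, m, i)) ` ({m. mdeg m \<le> j} \<times> UNIV)" by auto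
  qed
  then have fin: "finite (lead ` (V \<inter> vec_le j - {0}))"
    unfolding img by (rule finite_subset) (simp add: finite_mdeg_le)
  have sub: "KV.subspace (V \<inter> vec_le j)" using V subspace_vec_le by (rule KV.subspace_inter)
  have add: "co l (x + y) = co l x + co l y" and scl: "co l (kscale c x) = c * co l x" for l x y c
    by (auto simp: co_def lookup_add kscale_def lookup_mconst_mult split: prod.splits)
  have lead_nz: "co (lead v) v \<noteq> 0" if "v \<noteq> 0" for v
    using lead_in_terms[OF that] by (auto simp: co_def in_keys_iff)
  have lead_gt: "co l v = 0" if "lead v < l" for l v
  proof (cases l)
    case (fields d m i)
    then show ?thesis
      using lead_ge[where v = v and m = m and i = i] that by (force simp: co_def in_keys_iff)
  qed
  show ?dim
    using KV.dim_eq_card_leading(1)[of "V \<inter> vec_le j" co lead, OF sub add scl lead_nz lead_gt fin]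
    by (simp add: img kdim_eq)
  show ?fin
    by (rule KV.dim_eq_card_leading(2)[of "V \<inter> vec_le j" co lead, OF sub add scl lead_nz lead_gt fin])
qed

lemma kdim_vec_le:
  "kdim (vec_le j :: ('w::{finite,linorder} \<Rightarrow> ('v::{finite,linorder}, 'k::field) mpoly) set) =
    card (UNIV :: 'w set) * num_mons TYPE('v) j"
proof -
  have "{l \<in> lead ` (UNIV - {0 :: 'w \<Rightarrow> ('v, 'k) mpoly}). fst l \<le> j} =
      (\<lambda>(m, i). (mdeg m, m, i)) ` ({m. mdeg m \<le> j} \<times> UNIV)" (is "?L = ?R")
  proof (intro equalityI subsetI)
    fix l assume "l \<in> ?L"
    then obtain v :: "'w \<Rightarrow> ('v, 'k) mpoly" where v: "v \<noteq> 0" "l = lead v" "fst l \<le> j" by blast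
    with lead_in_terms[of v] obtain m i where "l = (mdeg m, m, i)" by auto
    with v(3) show "l \<in> ?R" by auto
  next
    fix l assume "l \<in> ?R"
    then obtain m i where l: "l = (mdeg m, m, i)" "mdeg m \<le> j" by auto
    define v :: "'w \<Rightarrow> ('v, 'k) mpoly" where "v = (\<lambda>k. if k = i then single m 1 else 0)"
    have "{(mdeg m', m', k) | m' k. m' \<in> keys (v k)} = {l}"
      by (auto simp: v_def l split: if_splits)
    then have "lead v = l" by (simp add: lead_def)
    moreover have "v \<noteq> 0"
    proof
      assume "v = 0"
      then have "lookup (v i) m = 0" by simp
      then show False by (simp add: v_def)
    qed
    ultimately show "l \<in> ?L" using l(2) image_eqI[of l lead v "UNIV - {0}"] by (auto simp: l(1))
  qed
  moreover have "card ?R = num_mons TYPE('v) j * card (UNIV :: 'w set)"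
    by (subst card_image) (auto simp: inj_on_def card_cartesian_product num_mons_def)
  ultimately show ?thesis
    using kdim_eq_card_lead(1)[of "UNIV :: ('w \<Rightarrow> ('v, 'k) mpoly) set" j]
    by (simp add: mult.commute)
qed

definition submodule :: "('w \<Rightarrow> ('u, 'k::comm_semiring_1) mpoly) set \<Rightarrow> bool" where
  "submodule D \<longleftrightarrow> 0 \<in> D \<and> (\<forall>v\<in>D. \<forall>w\<in>D. v + w \<in> D) \<and> (\<forall>c. \<forall>v\<in>D. (\<lambda>i. c * v i) \<in> D)"

lemma submodule_imp_subspace: "submodule D \<Longrightarrow> KV.subspace D"
  by (auto simp: submodule_def KV.subspace_def kscale_def)

text \<open>Multiplication by a monomial shifts all terms by a monotone map, and monotone maps
  commute with maxima. This makes the sets of leading monomials closed upwards.\<close>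

lemma lead_single_mult:
  fixes v :: "'w::{finite,linorder} \<Rightarrow> ('v::{finite,linorder}, 'k::field) mpoly"
  assumes "v \<noteq> 0" "lead v = (d, m, i)"
  shows "lead (\<lambda>i. single s 1 * v i) = (mdeg s + d, s + m, i)"
proof -
  define sh :: "nat \<times> ('v \<Rightarrow>\<^sub>0 nat) \<times> 'w \<Rightarrow> nat \<times> ('v \<Rightarrow>\<^sub>0 nat) \<times> 'w" where
    "sh = (\<lambda>(d, m, i). (mdeg s + d, s + m, i))"
  define T where "T = {(mdeg m, m, i) | m i. m \<in> keys (v i)}"
  have "mono sh"
    by (rule monoI) (auto simp: sh_def less_eq_prod_def)
  have keys: "keys (single s 1 * v k) = (+) s ` keys (v k)" for k
  proof (intro equalityI subsetI)
    fix n assume "n \<in> keys (single s 1 * v k)"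
    with keys_mult[of "single s 1" "v k"] show "n \<in> (+) s ` keys (v k)" by auto
  qed (auto simp: in_keys_iff lookup_single_mult_add)
  have "{(mdeg m, m, i) | m i. m \<in> keys (single s 1 * v i)} = sh ` T"
    unfolding keys T_def by (auto simp: sh_def image_iff)
  moreover have "T \<noteq> {}" "finite T"
    using lead_in_terms[OF assms(1)] finite_terms[of v] by (auto simp: T_def)
  ultimately have "lead (\<lambda>i. single s 1 * v i) = sh (lead v)"
    unfolding lead_def by (simp add: mono_Max_commute[OF \<open>mono sh\<close>] T_def)
  with assms show ?thesis by (simp add: sh_def)
qed

text \<open>One factor 1-t passes from leading terms of degree at most \<open>j\<close> to those of
  degree exactly \<open>j\<close>. These split by component \<open>i\<close> into monomial ideals
  \<open>U i\<close>, each of which needs one factor per variable.\<close>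

lemma Hilbert_Serre_filtered:
  fixes D :: "('w::{finite,linorder} \<Rightarrow> ('v::{finite,linorder}, 'k::field) mpoly) set"
  assumes D: "submodule D"
  shows "\<exists>p :: int poly. fps_of_poly p =
    (1 - fps_X) ^ (card (UNIV :: 'v set) + 1) * Abs_fps (\<lambda>j. int (kdim (D \<inter> vec_le j)))"
proof -
  define L where "L = lead ` (D - {0})"
  define U where "U i = {m. (mdeg m, m, i) \<in> L}" for i
  define H where "H = Abs_fps (\<lambda>j. int (kdim (D \<inter> vec_le j)))"
  have L_terms: "\<exists>m i. l = (mdeg m, m, i)" if "l \<in> L" for l
    using that lead_in_terms by (fastforce simp: L_def)
  have up: "upclosed UNIV (U i)" for i
    unfolding upclosed_def
  proof (intro ballI allI impI)
    fix m s assume "m \<in> U i"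
    then obtain v where v: "v \<in> D" "v \<noteq> 0" "(mdeg m, m, i) = lead v"
      by (auto simp: U_def L_def)
    let ?w = "\<lambda>i. single s 1 * v i"
    have "lead ?w = (mdeg (m + s), m + s, i)"
      using lead_single_mult[OF v(2) v(3)[symmetric], of s] by (simp add: add.commute)
    moreover have "?w \<in> D" using D v by (simp add: submodule_def)
    moreover have "?w \<noteq> 0"
    proof
      assume "?w = 0"
      then have w0: "single s 1 * v k = 0" for k by (simp add: fun_eq_iff del: mult_eq_0_iff)
      have "v k = 0" for k
      proof (rule poly_mapping_eqI)
        fix n
        show "lookup (v k) n = lookup 0 n"
          using lookup_single_mult_add[of s 1 "v k" n] w0[of k] by simp
      qed
      with v show False by (simp add: fun_eq_iff)
    qed
    ultimately show "m + s \<in> U i" unfolding U_def L_def by (metis (mono_tags) DiffI imageI mem_Collect_eq singletonD)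
  qed
  have card_deg: "card {l\<in>L. fst l = j} = (\<Sum>i\<in>UNIV. card {m\<in>U i. mdeg m = j})" for j
  proof -
    have "{l\<in>L. fst l = j} = (\<lambda>(i, m). (mdeg m, m, i)) ` (SIGMA i:UNIV. {m\<in>U i. mdeg m = j})"
      using L_terms by (fastforce simp: U_def image_iff)
    moreover have "inj_on (\<lambda>(i, m). (mdeg m, m, i)) (SIGMA i:UNIV. {m\<in>U i. mdeg m = j})"
      by (auto simp: inj_on_def)
    moreover have "finite {m\<in>U i. mdeg m = j}" for i
      by (rule finite_subset[OF _ finite_mdeg_le[of j]]) auto
    ultimately show ?thesis by (simp add: card_image card_SigmaI)
  qed
  have Hj: "kdim (D \<inter> vec_le j) = card {l\<in>L. fst l \<le> j}" for j
    unfolding L_def by (rule kdim_eq_card_lead(1)[OF submodule_imp_subspace[OF D]])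
  have finL: "finite {l\<in>L. fst l \<le> j}" for j
  proof -
    have "{l\<in>L. fst l \<le> j} \<subseteq> (\<lambda>(m, i). (mdeg m, m, i)) ` ({m. mdeg m \<le> j} \<times> UNIV)"
      using L_terms by fastforce
    then show ?thesis by (rule finite_subset) (simp add: finite_mdeg_le)
  qed
  have "(1 - fps_X) * H = (\<Sum>i\<in>UNIV. mono_series UNIV (U i))"
  proof (rule fps_ext)
    fix j
    have "int (card {l\<in>L. fst l \<le> j}) - (if j = 0 then 0 else int (card {l\<in>L. fst l \<le> j - 1})) =
        int (card {l\<in>L. fst l = j})"
    proof (cases j)
      case (Suc k)
      have "{l\<in>L. fst l \<le> j} = {l\<in>L. fst l \<le> k} \<union> {l\<in>L. fst l = j}" using Suc by auto
      moreover have "card ({l\<in>L. fst l \<le> k} \<union> {l\<in>L. fst l = j}) = card {l\<in>L. fst l \<le> k} + card {l\<in>L. fst l = j}"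
        using Suc by (intro card_Un_disjoint finite_subset[OF _ finL[of j]]) auto
      ultimately show ?thesis using Suc by simp
    qed simp
    then show "fps_nth ((1 - fps_X) * H) j = fps_nth (\<Sum>i\<in>UNIV. mono_series UNIV (U i)) j"
      by (cases "j = 0") (simp_all add: left_diff_distrib H_def Hj card_deg fps_sum_nth mono_series_def)
  qed
  then have eq: "(1 - fps_X) ^ (card (UNIV :: 'v set) + 1) * H =
      (\<Sum>i\<in>UNIV. (1 - fps_X) ^ card (UNIV :: 'v set) * mono_series UNIV (U i))"
    by (simp add: mult.assoc power_Suc2 sum_distrib_left del: power_Suc)
  obtain p :: "'w \<Rightarrow> int poly" where
    "\<And>i. fps_of_poly (p i) = (1 - fps_X) ^ card (UNIV :: 'v set) * mono_series UNIV (U i)"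
    using Hilbert_Serre_monomial[OF finite_UNIV up] by metis
  then have "fps_of_poly (\<Sum>i\<in>UNIV. p i) = (1 - fps_X) ^ (card (UNIV :: 'v set) + 1) * H"
    unfolding eq by (simp add: fps_of_poly_sum)
  then show ?thesis unfolding H_def by blast
qed

section \<open>Splitting off an irreducible factor\<close>

lemma app_der_zero: "app_der 0 g = 0"
  by (simp add: app_der_def)

lemma app_der_add: "app_der (a + b) g = app_der a g + app_der b g"
  by (simp add: app_der_def distrib_right sum.distrib)

lemma app_der_smult: "app_der (\<lambda>i. c * a i) g = c * app_der a g"
  by (simp add: app_der_def sum_distrib_left mult.assoc)

lemma app_der_mconst_mult: "app_der a (mconst c * g) = mconst c * app_der a g"
  by (simp add: app_der_def pdiff_mconst_mult sum_distrib_left mult.left_commute)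

lemma tdeg_app_der:
  fixes a :: "'v::finite \<Rightarrow> ('v, 'k::comm_semiring_1) mpoly"
  assumes "a \<in> vec_le j"
  shows "tdeg (app_der a g) \<le> j + (tdeg g - 1)"
  unfolding app_der_def
proof (rule tdeg_sum_le)
  fix i
  show "tdeg (a i * pdiff i g) \<le> j + (tdeg g - 1)"
    using tdeg_mult_le[of "a i" "pdiff i g"] tdeg_pdiff[of i g] assms
    by (fastforce simp: vec_le_def intro: order_trans add_mono)
qed

lemma submodule_Dge: "submodule (Dge g e)"
  by (auto simp: submodule_def Dge_def app_der_zero app_der_add app_der_smult)

lemma Dlog_eq_Inter:
  "Dlog f = (\<Inter>(g, e)\<in>{(g, e). irreducible g \<and> 1 \<le> e \<and> g ^ e dvd f \<and> \<not> g ^ Suc e dvd f}. Dge g e)"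
  by (auto simp: Dlog_def)

lemma submodule_Dlog: "submodule (Dlog f)"
  using submodule_Dge unfolding Dlog_eq_Inter submodule_def by fastforce

lemma Dlog_const: "tdeg f = 0 \<Longrightarrow> f \<noteq> 0 \<Longrightarrow> Dlog f = UNIV"
  for f :: "('v::{finite,linorder}, 'k::field) mpoly"
proof -
  assume "tdeg f = 0" "f \<noteq> 0"
  then have f: "f dvd 1" by (simp add: mpoly_dvd_1_iff)
  have False if "irreducible g" "1 \<le> e" "g ^ e dvd f" for g e
  proof -
    have "g dvd g ^ e" using that(2) by (simp add: dvd_power)
    then have "g dvd 1" using that(3) f by (metis dvd_trans)
    with that(1) show False by (simp add: irreducible_def)
  qed
  then show ?thesis by (auto simp: Dlog_def)
qed

text \<open>Each required power \<open>g ^ e\<close> divides \<open>f\<close>, hence also the image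
  of \<open>g\<close>. These derivations are the supply for the lower bound on the
  codimension.\<close>

lemma coordinate_multiple_in_Dlog:
  "(\<lambda>i. if i = x then u * f else 0) \<in> Dlog f"
proof -
  have "app_der (\<lambda>i. if i = x then u * f else 0) g = u * f * pdiff x g" for g
  proof -
    have "app_der (\<lambda>i. if i = x then u * f else 0) g = (\<Sum>i\<in>UNIV. if i = x then u * f * pdiff x g else 0)"
      unfolding app_der_def by (intro sum.cong) auto
    then show ?thesis by simp
  qed
  then show ?thesis by (auto simp: Dlog_def Dge_def)
qed

lemma prime_elem_power_dvd_mult:
  fixes p :: "'a::idom"
  assumes "prime_elem p" "\<not> p dvd b" "p ^ k dvd a * b"
  shows "p ^ k dvd a"
  using assms(3)
proof (induction k arbitrary: a)
  case (Suc k)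
  have "p dvd a * b" using dvd_trans[OF _ Suc.prems, of p] by simp
  then have "p dvd a" using assms(1,2) prime_elem_dvd_multD by blast
  then obtain a' where a': "a = p * a'" ..
  have "p \<noteq> 0" using assms(1) by (auto simp: prime_elem_def)
  with Suc.prems have "p ^ k dvd a' * b" by (simp add: a' mult.assoc)
  then have "p ^ k dvd a'" by (rule Suc.IH)
  then show ?case by (simp add: a')
qed simp

text \<open>By degrees the cofactor of associates is a constant, and derivations are linear over
  constants.\<close>

lemma Dge_associated:
  fixes g g' :: "('v::{finite,linorder}, 'k::field) mpoly"
  assumes "g dvd g'" "g' dvd g" "g' \<noteq> 0"
  shows "Dge g e \<subseteq> Dge g' e"
proof
  fix a assume a: "a \<in> Dge g e"
  from assms(1) obtain u where u: "g' = g * u" ..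
  with assms have nz: "g \<noteq> 0" "u \<noteq> 0" by auto
  have "tdeg g' \<le> tdeg g" using assms nz by (intro tdeg_dvd_le)
  then have "tdeg u = 0" using nz by (simp add: u tdeg_mult)
  then obtain c where "u = mconst c" by (auto simp: tdeg_eq_0_iff)
  then have "app_der a g' = u * app_der a g" by (simp add: u mult.commute[of g] app_der_mconst_mult)
  moreover have "g' ^ e dvd g ^ e" using assms(2) by (rule dvd_power_same)
  ultimately show "a \<in> Dge g' e" using a by (auto simp: Dge_def intro: dvd_trans)
qed

text \<open>As irreducibles are prime, \<open>g\<close> occurs in the product exactly to the power
  \<open>e\<close>, while an irreducible not associated to \<open>g\<close> has the same
  multiplicity in the product as in \<open>f'\<close>.\<close>

lemma Dlog_split:
  fixes f' g :: "('v::{finite,linorder}, 'k::field) mpoly"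
  assumes g: "irreducible g" and f': "\<not> g dvd f'" and e: "1 \<le> e"
  shows "Dlog (g ^ e * f') = Dlog f' \<inter> Dge g e"
proof -
  have prime: "prime_elem q" if "irreducible q" for q :: "('v, 'k) mpoly"
    using that by (rule irreducible_imp_prime_elem_mpoly)
  have nz: "q \<noteq> 0" if "irreducible q" for q :: "('v, 'k) mpoly"
    using that by (auto simp: irreducible_def)
  have assoc: "q dvd q'" if "irreducible q" "irreducible q'" "q' dvd q" for q q' :: "('v, 'k) mpoly"
  proof -
    from that(3) obtain u where u: "q = q' * u" ..
    with that have "u dvd 1" by (auto simp: irreducible_def)
    then have "q' * u dvd q' * 1" by (intro mult_dvd_mono) auto
    with u show ?thesis by simp
  qed
  have exp: "g ^ k dvd g ^ e * f' \<longleftrightarrow> k \<le> e" for k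
  proof
    show "k \<le> e" if *: "g ^ k dvd g ^ e * f'"
    proof (rule ccontr)
      assume "\<not> k \<le> e"
      then have "g ^ Suc e dvd g ^ e * f'" using * by (meson dvd_trans le_imp_power_dvd not_less_eq_eq)
      with nz[OF g] f' show False by (simp add: mult.commute[of g])
    qed
  qed (simp add: dvd_mult2 le_imp_power_dvd)
  have other: "q ^ k dvd g ^ e * f' \<longleftrightarrow> q ^ k dvd f'" if "irreducible q" "\<not> q dvd g" for q k
  proof
    have "\<not> q dvd g ^ e" using that prime by (metis prime_elem_dvd_power)
    then show "q ^ k dvd f'" if "q ^ k dvd g ^ e * f'"
      using prime_elem_power_dvd_mult[OF prime[OF \<open>irreducible q\<close>], of "g ^ e" k f'] that by (simp add: mult.commute)
  qed simp
  show ?thesis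
  proof (intro equalityI subsetI IntI)
    fix a assume a: "a \<in> Dlog (g ^ e * f')"
    show "a \<in> Dge g e" using a g e exp by (auto simp: Dlog_def simp del: power_Suc)
    show "a \<in> Dlog f'"
      unfolding Dlog_def
    proof (intro CollectI allI impI)
      fix q k assume q: "irreducible q \<and> 1 \<le> k \<and> q ^ k dvd f' \<and> \<not> q ^ Suc k dvd f'"
      have "\<not> q dvd g"
      proof
        assume "q dvd g"
        then have "g dvd q" using assoc q g by blast
        also have "q dvd q ^ k" using q by (simp add: dvd_power)
        also have "q ^ k dvd f'" using q by simp
        finally show False using f' by simp
      qed
      then show "a \<in> Dge q k" using a q other[of q k] other[of q "Suc k"] unfolding Dlog_def by blast
    qed
  next
    fix a assume a: "a \<in> Dlog f' \<inter> Dge g e"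
    show "a \<in> Dlog (g ^ e * f')"
      unfolding Dlog_def
    proof (intro CollectI allI impI)
      fix q k assume q: "irreducible q \<and> 1 \<le> k \<and> q ^ k dvd g ^ e * f' \<and> \<not> q ^ Suc k dvd g ^ e * f'"
      show "a \<in> Dge q k"
      proof (cases "q dvd g")
        case True
        then have gq: "g dvd q" using assoc q g by blast
        have "q ^ l dvd g ^ e * f' \<longleftrightarrow> l \<le> e" for l
          unfolding exp[symmetric] using gq True by (meson dvd_power_same dvd_trans)
        with q have "k = e" by (metis le_antisym not_less_eq_eq)
        with Dge_associated[OF gq True] nz q a show ?thesis by blast
      next
        case False
        then show ?thesis using a q other[of q k] other[of q "Suc k"] unfolding Dlog_def by blast
      qed
    qed
  qed
qed

lemma linear_mult: "Vector_Spaces.linear pscale pscale (\<lambda>u. q * u)"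
  for q :: "('v, 'k::field) mpoly"
  by unfold_locales (simp_all add: pscale_def algebra_simps)

text \<open>Multiplication by \<open>q\<close> is injective and shifts degrees by exactly
  \<open>tdeg q\<close>.\<close>

lemma dim_multiples:
  fixes q :: "('v::{finite,linorder}, 'k::field) mpoly"
  assumes "q \<noteq> 0" "tdeg q \<le> k"
  shows "PV.dim {p \<in> mpoly_le k. q dvd p} = num_mons TYPE('v) (k - tdeg q)"
proof -
  have "{p \<in> mpoly_le k. q dvd p} = (\<lambda>u. q * u) ` mpoly_le (k - tdeg q)"
  proof (intro equalityI subsetI)
    fix p assume p: "p \<in> {p \<in> mpoly_le k. q dvd p}"
    then obtain u where u: "p = q * u" by auto
    have "tdeg u \<le> k - tdeg q"
      using p assms by (cases "u = 0") (auto simp: u mpoly_le_def tdeg_mult)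
    then show "p \<in> (\<lambda>u. q * u) ` mpoly_le (k - tdeg q)" by (auto simp: u mpoly_le_def)
  next
    fix p assume "p \<in> (\<lambda>u. q * u) ` mpoly_le (k - tdeg q)"
    then obtain u where u: "p = q * u" "tdeg u \<le> k - tdeg q" by (auto simp: mpoly_le_def)
    then show "p \<in> {p \<in> mpoly_le k. q dvd p}"
      using tdeg_mult_le[of q u] assms by (auto simp: mpoly_le_def)
  qed
  moreover have "PV.dim ((\<lambda>u. q * u) ` mpoly_le (k - tdeg q)) = PV.dim (mpoly_le (k - tdeg q) :: ('v, 'k) mpoly set)"
    by (rule PP.dim_image_inj_on[OF linear_mult subspace_mpoly_le finite_dim_mpoly_le]) (use assms in simp)
  ultimately show ?thesis by (simp add: dim_mpoly_le)
qed

lemma linear_compose_fun: "Vector_Spaces.linear s1 s2 f \<Longrightarrow> Vector_Spaces.linear s2 s3 g \<Longrightarrow>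
    Vector_Spaces.linear s1 s3 (\<lambda>x. g (f x))"
  using Vector_Spaces.linear_compose[of s1 s2 f s3 g] by (simp add: comp_def)

text \<open>Rank-nullity for \<open>T\<close>, the map sending a derivation in D(f') to the class of
  its value at \<open>g\<close> modulo \<open>g ^ e\<close>; its kernel is D(g^e f'). Both bounds
  compare the image of \<open>T\<close> with a piece of S/(g^e), whose dimension is a difference of
  two monomial counts \<open>m\<close> degrees apart.\<close>

lemma
  fixes f' g :: "('v::{finite,linorder}, 'k::field_char_0) mpoly"
  assumes g: "irreducible g" and f': "\<not> g dvd f'" and e: "1 \<le> e"
  defines "H f j \<equiv> kdim (Dlog f \<inter> vec_le j)" and "m \<equiv> e * tdeg g"
  shows kdim_Dlog_split_upper: "m \<le> j \<Longrightarrow>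
      H f' j + num_mons TYPE('v) (j + (tdeg g - 1) - m) \<le> H (g ^ e * f') j + num_mons TYPE('v) (j + (tdeg g - 1))"
    and kdim_Dlog_split_lower: "tdeg f' + m \<le> j \<Longrightarrow>
      H (g ^ e * f') j + num_mons TYPE('v) (j - tdeg f') \<le> H f' j + num_mons TYPE('v) (j - tdeg f' - m)"
proof -
  have "g \<noteq> 0" "\<not> g dvd 1" using g by (auto simp: irreducible_def)
  then have tg: "tdeg g > 0" by (simp add: mpoly_dvd_1_iff)
  have ge: "g ^ e \<noteq> 0" "tdeg (g ^ e) = m" using \<open>g \<noteq> 0\<close> by (auto simp: tdeg_power m_def)
  \<comment> \<open>\<open>\<pi>\<close> stands in for the residue map to S/(g^e), and
    \<open>dim_\<pi>\<close> computes the dimension of the residue classes of polynomials of degree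
    at most \<open>k\<close>.\<close>
  define W where "W = {p. g ^ e dvd p}"
  have "PV.subspace W" by (auto simp: W_def PV.subspace_def pscale_def)
  then obtain \<pi> :: "('v, 'k) mpoly \<Rightarrow> ('v, 'k) mpoly" where \<pi>: "Vector_Spaces.linear pscale pscale \<pi>" "\<And>p. \<pi> p = 0 \<longleftrightarrow> p \<in> W"
    by (rule PV.exists_linear_with_kernel) blast
  have dim_\<pi>: "num_mons TYPE('v) k = num_mons TYPE('v) (k - m) + PV.dim (\<pi> ` mpoly_le k)" if "m \<le> k" for k
    using PP.rank_nullity[OF \<pi>(1) subspace_mpoly_le finite_dim_mpoly_le, of k] dim_multiples[OF ge(1), of k] that ge
    by (simp add: \<pi>(2) W_def dim_mpoly_le)
  have lin_der: "Vector_Spaces.linear kscale pscale (\<lambda>a. app_der a g)"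
    by unfold_locales (simp_all add: app_der_add app_der_smult kscale_def pscale_def)
  define T where "T a = \<pi> (app_der a g)" for a
  have lin_T: "Vector_Spaces.linear kscale pscale T"
    unfolding T_def using lin_der \<pi>(1) by (rule linear_compose_fun)
  define V where "V j = Dlog f' \<inter> vec_le j" for j
  have subV: "KV.subspace (V j)" for j
    unfolding V_def using submodule_imp_subspace[OF submodule_Dlog] subspace_vec_le by (rule KV.subspace_inter)
  have finV: "finite_dim kscale (V j)" for j
    unfolding V_def by (rule kdim_eq_card_lead(2)[OF submodule_imp_subspace[OF submodule_Dlog]])
  have "{a \<in> V j. T a = 0} = Dlog (g ^ e * f') \<inter> vec_le j" for j
    unfolding Dlog_split[OF g f' e] by (auto simp: V_def T_def \<pi>(2) W_def Dge_def)
  then have HT: "H f' j = H (g ^ e * f') j + PV.dim (T ` V j)" for j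
    using KP.rank_nullity[OF lin_T subV finV, of j] by (simp add: H_def kdim_eq V_def)
  have finT: "finite_dim pscale (T ` V j)" for j
    using lin_T finV by (rule KP.finite_dim_image)
  {
    assume "m \<le> j"
    have "T ` V j \<subseteq> \<pi> ` mpoly_le (j + (tdeg g - 1))"
      using tdeg_app_der[of _ j g] by (auto simp: T_def V_def mpoly_le_def)
    then have "PV.dim (T ` V j) \<le> PV.dim (\<pi> ` mpoly_le (j + (tdeg g - 1)))"
      by (intro PV.finite_dim_dim_mono PP.finite_dim_image[OF \<pi>(1) finite_dim_mpoly_le])
    with HT[of j] dim_\<pi>[of "j + (tdeg g - 1)"] \<open>m \<le> j\<close>
    show "H f' j + num_mons TYPE('v) (j + (tdeg g - 1) - m) \<le> H (g ^ e * f') j + num_mons TYPE('v) (j + (tdeg g - 1))"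
      by simp
  }
  {
    assume j: "tdeg f' + m \<le> j"
    obtain x where x: "pdiff x g \<noteq> 0" using pdiff_nonzero[OF tg] .
    have "\<not> g dvd pdiff x g"
      using tdeg_dvd_le[of g "pdiff x g"] x tdeg_pdiff[of x g] tg by auto
    then have q: "\<not> g dvd f' * pdiff x g"
      using f' irreducible_imp_prime_elem_mpoly[OF g] prime_elem_dvd_multD by blast
    define q where "q = f' * pdiff x g"
    define k where "k = j - tdeg f'"
    \<comment> \<open>\<open>q\<close> is prime to \<open>g\<close>, so multiplication by
      \<open>q\<close> is injective modulo \<open>g ^ e\<close>. The kernel of the composite with
      \<open>\<pi>\<close> is thus the ideal of \<open>g ^ e\<close> itself.\<close>
    have dvd_iff: "g ^ e dvd q * u \<longleftrightarrow> g ^ e dvd u" for u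
      using prime_elem_power_dvd_mult[OF irreducible_imp_prime_elem_mpoly[OF g] q, of e u]
      by (auto simp: q_def mult.commute)
    have "(\<lambda>u. \<pi> (q * u)) ` mpoly_le k \<subseteq> T ` V j"
    proof
      fix y assume "y \<in> (\<lambda>u. \<pi> (q * u)) ` mpoly_le k"
      then obtain u where u: "tdeg u \<le> k" "y = \<pi> (q * u)" by (auto simp: mpoly_le_def)
      \<comment> \<open>The derivation u f' d/dx, of degree at most \<open>j\<close> by the choice
        of \<open>k\<close>, takes the value \<open>q * u\<close> at \<open>g\<close>.\<close>
      define a where "a = (\<lambda>i. if i = x then u * f' else 0)"
      have "app_der a g = (\<Sum>i\<in>UNIV. if i = x then u * f' * pdiff x g else 0)"
        unfolding app_der_def a_def by (intro sum.cong) auto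
      then have "T a = y" by (simp add: T_def u q_def mult_ac)
      moreover have "a \<in> Dlog f'" unfolding a_def by (rule coordinate_multiple_in_Dlog)
      moreover have "a \<in> vec_le j"
        using tdeg_mult_le[of u f'] u j by (auto simp: a_def vec_le_def k_def)
      ultimately show "y \<in> T ` V j" by (auto simp: V_def)
    qed
    then have "PV.dim ((\<lambda>u. \<pi> (q * u)) ` mpoly_le k) \<le> PV.dim (T ` V j)"
      by (intro PV.finite_dim_dim_mono finT)
    moreover have "num_mons TYPE('v) k = num_mons TYPE('v) (k - m) + PV.dim ((\<lambda>u. \<pi> (q * u)) ` mpoly_le k)"
      using PP.rank_nullity[OF linear_compose_fun[OF linear_mult[of q] \<pi>(1)] subspace_mpoly_le finite_dim_mpoly_le, of k]
        dim_multiples[OF ge(1), of k] ge j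
      by (simp add: \<pi>(2) W_def dim_mpoly_le dvd_iff k_def)
    ultimately show "H (g ^ e * f') j + num_mons TYPE('v) (j - tdeg f') \<le> H f' j + num_mons TYPE('v) (j - tdeg f' - m)"
      using HT[of j] by (simp add: k_def)
  }
qed

section \<open>Homogenisation\<close>

text \<open>Linear extension of a map of exponents, the common form of homogenisation and
  dehomogenisation; it is a ring map when \<open>\<phi>\<close> is additive.\<close>

definition map_mons :: "('a \<Rightarrow> 'b) \<Rightarrow> ('a \<Rightarrow>\<^sub>0 'k::comm_monoid_add) \<Rightarrow> ('b \<Rightarrow>\<^sub>0 'k)" where
  "map_mons \<phi> p = (\<Sum>m\<in>keys p. single (\<phi> m) (lookup p m))"

lemma map_mons_zero [simp]: "map_mons \<phi> 0 = 0"
  by (simp add: map_mons_def)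

lemma map_mons_add: "map_mons \<phi> (p + q) = map_mons \<phi> p + map_mons \<phi> q"
  unfolding map_mons_def by (rule setsum_keys_plus_distrib) (simp_all add: single_add)

lemma map_mons_single [simp]: "map_mons \<phi> (single m c) = single (\<phi> m) c"
  by (cases "c = 0") (simp_all add: map_mons_def)

lemma map_mons_sum: "map_mons \<phi> (sum g A) = (\<Sum>x\<in>A. map_mons \<phi> (g x))"
  by (rule additive_sum) (simp_all add: map_mons_add)

lemma map_mons_map_mons: "map_mons \<phi> (map_mons \<psi> p) = map_mons (\<lambda>m. \<phi> (\<psi> m)) p"
  by (simp add: map_mons_def[of \<psi>] map_mons_sum) (simp add: map_mons_def)

lemma map_mons_cong: "(\<And>m. m \<in> keys p \<Longrightarrow> \<phi> m = \<psi> m) \<Longrightarrow> map_mons \<phi> p = map_mons \<psi> p"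
  by (simp add: map_mons_def)

lemma map_mons_ident [simp]: "map_mons (\<lambda>m. m) p = p"
  by (simp add: map_mons_def sum_single_lookup)

lemma keys_map_mons: "keys (map_mons \<phi> p) \<subseteq> \<phi> ` keys p"
  unfolding map_mons_def
proof
  fix n assume "n \<in> keys (\<Sum>m\<in>keys p. single (\<phi> m) (lookup p m))"
  then have "(\<Sum>m\<in>keys p. lookup (single (\<phi> m) (lookup p m)) n) \<noteq> 0"
    by (simp add: in_keys_iff lookup_sum)
  then obtain m where "m \<in> keys p" "lookup (single (\<phi> m) (lookup p m)) n \<noteq> 0"
    by (meson sum.neutral)
  then show "n \<in> \<phi> ` keys p" by (auto simp: lookup_single when_def split: if_splits)
qed

lemma map_mons_mult:
  fixes p q :: "'a::comm_monoid_add \<Rightarrow>\<^sub>0 'k::comm_semiring_0" and \<phi> :: "'a \<Rightarrow> 'b::comm_monoid_add"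
  assumes "\<And>m n. \<phi> (m + n) = \<phi> m + \<phi> n"
  shows "map_mons \<phi> (p * q) = map_mons \<phi> p * map_mons \<phi> q"
  by (rule multiplicative_if_on_singles) (simp_all add: map_mons_add mult_single assms)

lemma single_mult_map_mons:
  "single s 1 * map_mons \<phi> p = map_mons (\<lambda>m. s + \<phi> m) p"
  for p :: "'a \<Rightarrow>\<^sub>0 'k::comm_semiring_1" and \<phi> :: "'a \<Rightarrow> 'b::comm_monoid_add"
  by (simp add: map_mons_def sum_distrib_left mult_single)

lemma mconst_mult_eq_map: "mconst c * p = (\<Sum>m\<in>keys p. single m (c * lookup p m))"
  for p :: "('v, 'k::comm_semiring_1) mpoly"
proof -
  have "mconst c * p = mconst c * (\<Sum>m\<in>keys p. single m (lookup p m))"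
    by (simp add: sum_single_lookup)
  then show ?thesis by (simp add: mconst_def sum_distrib_left mult_single)
qed

lemma map_mons_mconst_mult: "map_mons \<phi> (mconst c * p) = mconst c * map_mons \<phi> p"
  for p :: "('v, 'k::comm_semiring_1) mpoly" and \<phi> :: "_ \<Rightarrow> ('w \<Rightarrow>\<^sub>0 nat)"
  by (simp add: mconst_mult_eq_map[of c p] map_mons_sum)
    (simp add: map_mons_def mconst_def sum_distrib_left mult_single)

lemma lookup_hmono: "lookup (hmono m e) k = (case k of None \<Rightarrow> e | Some i \<Rightarrow> lookup m i)"
  for m :: "'v::finite \<Rightarrow>\<^sub>0 nat"
  unfolding hmono_def by (subst lookup_Abs_poly_mapping) auto

definition drop_h :: "('v::finite option \<Rightarrow>\<^sub>0 nat) \<Rightarrow> ('v \<Rightarrow>\<^sub>0 nat)" where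
  "drop_h m = Abs_poly_mapping (\<lambda>i. lookup m (Some i))"

lemma lookup_drop_h: "lookup (drop_h m) i = lookup m (Some i)"
  unfolding drop_h_def by (subst lookup_Abs_poly_mapping) auto

lemma drop_h_add: "drop_h (m + n) = drop_h m + drop_h n"
  by (intro poly_mapping_eqI) (simp add: lookup_drop_h lookup_add)

lemma drop_h_hmono [simp]: "drop_h (hmono m e) = m"
  by (intro poly_mapping_eqI) (simp add: lookup_drop_h lookup_hmono)

lemma hmono_drop_h: "hmono (drop_h m) (lookup m None) = m"
  by (intro poly_mapping_eqI) (simp add: lookup_drop_h lookup_hmono split: option.split)

lemma sum_UNIV_option: "(\<Sum>k\<in>(UNIV :: 'v::finite option set). h k) = h None + (\<Sum>i\<in>UNIV. h (Some i))"
  for h :: "_ \<Rightarrow> 'b::comm_monoid_add"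
  by (simp add: UNIV_option_conv sum.reindex)

lemma mdeg_option: "mdeg m = lookup m None + mdeg (drop_h m)"
  by (simp add: mdeg_eq_sum sum_UNIV_option lookup_drop_h)

text \<open>Homogenisation to a prescribed degree, h^(j - deg p) p^h. The truncated
  \<open>j - mdeg m\<close> has the intended meaning only for \<open>tdeg p \<le> j\<close>.\<close>

definition homog_to :: "nat \<Rightarrow> ('v::finite, 'k::comm_monoid_add) mpoly \<Rightarrow> ('v option, 'k) mpoly" where
  "homog_to j = map_mons (\<lambda>m. hmono m (j - mdeg m))"

definition dehom :: "('v::finite option, 'k::comm_monoid_add) mpoly \<Rightarrow> ('v, 'k) mpoly" where
  "dehom = map_mons drop_h"

lemma homog_eq_homog_to: "homog p = homog_to (tdeg p) p"
  by (simp add: homog_def homog_to_def map_mons_def)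

lemma dehom_homog_to [simp]: "dehom (homog_to j p) = p"
  by (simp add: dehom_def homog_to_def map_mons_map_mons)

lemma homogeneous_homog_to:
  assumes "tdeg p \<le> j"
  shows "homogeneous_of j (homog_to j p)"
  unfolding homogeneous_of_def
proof
  fix n assume "n \<in> keys (homog_to j p)"
  then obtain m where m: "m \<in> keys p" "n = hmono m (j - mdeg m)"
    using subsetD[OF keys_map_mons[of "\<lambda>m. hmono m (j - mdeg m)" p]] by (auto simp: homog_to_def)
  with assms show "mdeg n = j"
    using mdeg_le_tdeg[OF m(1)] by (simp add: mdeg_option lookup_hmono)
qed

lemma homog_to_dehom:
  assumes "homogeneous_of j p"
  shows "homog_to j (dehom p) = p"
proof -
  have "map_mons (\<lambda>m. hmono (drop_h m) (j - mdeg (drop_h m))) p = map_mons (\<lambda>m. m) p"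
  proof (rule map_mons_cong)
    fix m assume "m \<in> keys p"
    then have "mdeg m = j" using assms by (simp add: homogeneous_of_def)
    then have "j - mdeg (drop_h m) = lookup m None" by (simp add: mdeg_option)
    then show "hmono (drop_h m) (j - mdeg (drop_h m)) = m" by (simp add: hmono_drop_h)
  qed
  then show ?thesis by (simp add: homog_to_def dehom_def map_mons_map_mons)
qed

lemma tdeg_dehom:
  assumes "homogeneous_of j p"
  shows "tdeg (dehom p) \<le> j"
  unfolding tdeg_le_iff
proof
  fix n assume "n \<in> keys (dehom p)"
  then obtain m where "m \<in> keys p" "n = drop_h m"
    using subsetD[OF keys_map_mons[of drop_h p]] by (auto simp: dehom_def)
  with assms show "mdeg n \<le> j" by (auto simp: homogeneous_of_def mdeg_option)
qed

lemma hvar_power_mult_homog_to: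
  fixes p :: "('v::finite, 'k::comm_semiring_1) mpoly"
  assumes "tdeg p \<le> d"
  shows "hvar ^ k * homog_to d p = homog_to (k + d) p"
  unfolding hvar_def mvar_power homog_to_def single_mult_map_mons
proof (rule map_mons_cong)
  fix m assume "m \<in> keys p"
  from mdeg_le_tdeg[OF this] assms have "k + (d - mdeg m) = k + d - mdeg m" by simp
  then show "single None k + hmono m (d - mdeg m) = hmono m (k + d - mdeg m)"
    by (intro poly_mapping_eqI) (auto simp: lookup_add lookup_hmono lookup_single when_def split: option.split)
qed

definition der_deg :: "('v::finite \<Rightarrow> ('v, 'k::zero) mpoly) \<Rightarrow> nat" where
  "der_deg a = Max (tdeg ` {a i | i. a i \<noteq> 0})"

lemma tdeg_le_der_deg:
  fixes a :: "'v::finite \<Rightarrow> ('v, 'k::zero) mpoly"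
  assumes "a i \<noteq> 0"
  shows "tdeg (a i) \<le> der_deg a"
  unfolding der_deg_def using assms by (intro Max_ge) auto

lemma der_deg_le:
  fixes a :: "'v::finite \<Rightarrow> ('v, 'k::zero) mpoly"
  assumes "a \<noteq> (\<lambda>_. 0)" "a \<in> vec_le j"
  shows "der_deg a \<le> j"
proof -
  obtain i where "a i \<noteq> 0" using assms by (auto simp: fun_eq_iff)
  then have "tdeg ` {a i | i. a i \<noteq> 0} \<noteq> {}" by auto
  moreover have "finite (tdeg ` {a i | i. a i \<noteq> 0})" by simp
  ultimately show ?thesis unfolding der_deg_def using assms(2) by (subst Max_le_iff) (auto simp: vec_le_def)
qed

text \<open>The powers of h in the definition lift every coefficient to the common degree. For
  \<open>a = 0\<close> the maximum is over the empty set, but the zero coefficients are sent to 0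
  whatever its value.\<close>

lemma homog_der_eq:
  "homog_der a = (\<lambda>i. homog_to (der_deg a) (a i))"
proof
  fix i
  show "homog_der a i = homog_to (der_deg a) (a i)"
  proof (cases "a i = 0")
    case True
    then show ?thesis by (simp add: homog_der_def homog_to_def)
  next
    case False
    then have "homog_der a i = hvar ^ (der_deg a - tdeg (a i)) * homog_to (tdeg (a i)) (a i)"
      by (simp add: homog_der_def Let_def der_deg_def homog_eq_homog_to)
    also have "\<dots> = homog_to (der_deg a) (a i)"
      using tdeg_le_der_deg[of a i] False by (simp add: hvar_power_mult_homog_to)
    finally show ?thesis .
  qed
qed

text \<open>Setting h = 1 is a ring map that takes each generator back to the derivation it came
  from, and D(f) is a submodule.\<close>

lemma dehom_in_Dlog:
  assumes "v \<in> Dlog_h f"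
  shows "(\<lambda>i. dehom (v i)) \<in> Dlog f"
proof -
  have add: "dehom (x + y) = dehom x + dehom y" and mult: "dehom (x * y) = dehom x * dehom y"
    for x y :: "('a option, 'b) mpoly"
    by (simp_all add: dehom_def map_mons_add map_mons_mult drop_h_add)
  have mem: "(\<lambda>i. dehom (sum_list (map (\<lambda>(c, g). c * g i) ps))) \<in> Dlog f"
    if "set (map snd ps) \<subseteq> homog_der ` (Dlog f - {\<lambda>_. 0})" for ps
    using that
  proof (induction ps)
    case Nil
    then show ?case using submodule_Dlog[of f] by (simp add: submodule_def dehom_def zero_fun_def)
  next
    case (Cons cg ps)
    obtain c a where cg: "cg = (c, homog_der a)" "a \<in> Dlog f" using Cons.prems by (cases cg) auto
    have "(\<lambda>i. dehom c * a i) + (\<lambda>i. dehom (sum_list (map (\<lambda>(c, g). c * g i) ps))) \<in> Dlog f"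
      using Cons cg submodule_Dlog[of f] by (auto simp: submodule_def)
    then show ?case by (simp add: cg add mult homog_der_eq plus_fun_def)
  qed
  from assms obtain ps where "set (map snd ps) \<subseteq> homog_der ` (Dlog f - {\<lambda>_. 0})"
    "v = (\<lambda>i. sum_list (map (\<lambda>(c, g). c * g i) ps))" by (auto simp: Dlog_h_def gen_submod_def)
  with mem[of ps] show ?thesis by simp
qed

text \<open>A homogeneous vector of degree \<open>j\<close> is recovered from its dehomogenisation.
  Conversely, a derivation of degree \<open>e \<le> j\<close> contributes h^(j-e) times its
  homogenisation, a multiple of a generator.\<close>

lemma graded_piece_Dlog_h:
  "graded_piece (Dlog_h f) j = (\<lambda>a i. homog_to j (a i)) ` (Dlog f \<inter> vec_le j)"
proof (intro equalityI subsetI)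
  fix v assume "v \<in> graded_piece (Dlog_h f) j"
  then have v: "v \<in> Dlog_h f" "\<And>i. homogeneous_of j (v i)" by (auto simp: graded_piece_def)
  have "v = (\<lambda>i. homog_to j (dehom (v i)))" by (simp add: homog_to_dehom v)
  moreover have "(\<lambda>i. dehom (v i)) \<in> Dlog f \<inter> vec_le j"
    using dehom_in_Dlog[OF v(1)] tdeg_dehom[OF v(2)] by (simp add: vec_le_def)
  ultimately show "v \<in> (\<lambda>a i. homog_to j (a i)) ` (Dlog f \<inter> vec_le j)"
    by (rule image_eqI[where x = "\<lambda>i. dehom (v i)"])
next
  fix v assume "v \<in> (\<lambda>a i. homog_to j (a i)) ` (Dlog f \<inter> vec_le j)"
  then obtain a where a: "a \<in> Dlog f" "a \<in> vec_le j" "v = (\<lambda>i. homog_to j (a i))" by auto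
  have "v \<in> Dlog_h f"
  proof (cases "a = (\<lambda>_. 0)")
    case True
    then show ?thesis
      unfolding Dlog_h_def gen_submod_def by (intro CollectI exI[of _ "[]"]) (simp add: a homog_to_def)
  next
    case False
    define e where "e = der_deg a"
    have "e \<le> j" using der_deg_le[OF False a(2)] by (simp add: e_def)
    have "v i = hvar ^ (j - e) * homog_der a i" for i
    proof (cases "a i = 0")
      case True
      then show ?thesis by (simp add: a homog_der_eq homog_to_def)
    next
      case nz: False
      show ?thesis
        using hvar_power_mult_homog_to[OF tdeg_le_der_deg[of a i, OF nz], of "j - e"] \<open>e \<le> j\<close>
        by (simp add: a homog_der_eq e_def)
    qed
    then show ?thesis
      unfolding Dlog_h_def gen_submod_def using a False
      by (intro CollectI exI[of _ "[(hvar ^ (j - e), homog_der a)]"]) auto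
  qed
  moreover have "homogeneous_of j (v i)" for i
    using a by (simp add: vec_le_def homogeneous_homog_to)
  ultimately show "v \<in> graded_piece (Dlog_h f) j" by (simp add: graded_piece_def)
qed

lemma kdim_graded_piece_Dlog_h:
  fixes f :: "('n::{finite,linorder}, 'k::field) mpoly"
  shows "kdim (graded_piece (Dlog_h f) j) = kdim (Dlog f \<inter> vec_le j)"
proof -
  have lin: "Vector_Spaces.linear kscale kscale (\<lambda>(a :: 'n \<Rightarrow> ('n, 'k) mpoly) i. homog_to j (a i))"
    by unfold_locales (simp_all add: fun_eq_iff kscale_def homog_to_def map_mons_add map_mons_mconst_mult)
  have "a = 0" if "(\<lambda>i. homog_to j (a i)) = 0" for a :: "'n \<Rightarrow> ('n, 'k) mpoly"
  proof
    fix i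
    have "dehom (homog_to j (a i)) = dehom 0" using fun_cong[OF that, of i] by simp
    then show "a i = 0 i" by simp (simp add: dehom_def)
  qed
  moreover have "KV.subspace (Dlog f \<inter> vec_le j)"
    using submodule_imp_subspace[OF submodule_Dlog] subspace_vec_le by (rule KV.subspace_inter)
  moreover have "finite_dim kscale (Dlog f \<inter> vec_le j)"
    by (rule kdim_eq_card_lead(2)[OF submodule_imp_subspace[OF submodule_Dlog]])
  ultimately show ?thesis
    using KK.dim_image_inj_on[OF lin] by (simp add: graded_piece_Dlog_h kdim_eq)
qed

section \<open>Asymptotics of the codimension\<close>

lemma one_minus_fps_X_neq_0: "(1 - fps_X :: int fps) \<noteq> 0"
proof
  assume "(1 - fps_X :: int fps) = 0"
  then have "fps_nth (1 - fps_X :: int fps) 0 = 0" by simp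
  then show False by simp
qed

text \<open>Pascal's rule, in the form of the expansion of 1/(1-t)^(N+1).\<close>

lemma one_minus_fps_X_power_binomial:
  "(1 - fps_X) ^ Suc N * Abs_fps (\<lambda>k. int ((k + N) choose N)) = 1"
proof (induction N)
  case 0
  show ?case by (rule fps_ext) (simp add: left_diff_distrib)
next
  case (Suc N)
  have "(1 - fps_X) * Abs_fps (\<lambda>k. int ((k + Suc N) choose Suc N)) = Abs_fps (\<lambda>k. int ((k + N) choose N))"
  proof (rule fps_ext)
    fix k
    show "fps_nth ((1 - fps_X) * Abs_fps (\<lambda>k. int ((k + Suc N) choose Suc N))) k =
        fps_nth (Abs_fps (\<lambda>k. int ((k + N) choose N))) k"
      by (cases k) (simp_all add: left_diff_distrib)
  qed
  with Suc show ?case by (simp only: power_Suc2[of _ "Suc N"] mult.assoc)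
qed

lemma num_mons_eq_binomial:
  "num_mons TYPE('v::finite) j = (j + card (UNIV :: 'v set)) choose card (UNIV :: 'v set)"
proof -
  define n M where "n = card (UNIV :: 'v set)" and "M = Abs_fps (\<lambda>j. int (num_mons TYPE('v) j))"
  have "(1 - fps_X) * M = mono_series UNIV (UNIV :: ('v \<Rightarrow>\<^sub>0 nat) set)"
  proof (rule fps_ext)
    fix j
    show "fps_nth ((1 - fps_X) * M) j = fps_nth (mono_series UNIV (UNIV :: ('v \<Rightarrow>\<^sub>0 nat) set)) j"
    proof (cases j)
      case 0
      then show ?thesis by (simp add: left_diff_distrib M_def mono_series_def num_mons_def)
    next
      case (Suc k)
      have "{m :: 'v \<Rightarrow>\<^sub>0 nat. mdeg m \<le> j} = {m. mdeg m \<le> k} \<union> {m. mdeg m = j}" using Suc by auto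
      moreover have "card ({m :: 'v \<Rightarrow>\<^sub>0 nat. mdeg m \<le> k} \<union> {m. mdeg m = j}) =
          card {m :: 'v \<Rightarrow>\<^sub>0 nat. mdeg m \<le> k} + card {m :: 'v \<Rightarrow>\<^sub>0 nat. mdeg m = j}"
        using Suc by (intro card_Un_disjoint finite_subset[OF _ finite_mdeg_le[of j]]) auto
      ultimately show ?thesis using Suc by (simp add: left_diff_distrib M_def mono_series_def num_mons_def)
    qed
  qed
  then have "(1 - fps_X) ^ Suc n * M = 1"
    using mono_series_UNIV[of "UNIV :: 'v set"] by (simp add: n_def mult.assoc power_Suc2 del: power_Suc)
  also have "1 = (1 - fps_X) ^ Suc n * Abs_fps (\<lambda>k. int ((k + n) choose n))"
    by (simp only: one_minus_fps_X_power_binomial)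
  finally have "M = Abs_fps (\<lambda>k. int ((k + n) choose n))"
    using one_minus_fps_X_neq_0 by (simp del: power_Suc)
  then have "fps_nth M j = int ((j + n) choose n)" by simp
  then show ?thesis by (simp add: M_def n_def)
qed

text \<open>The shift \<open>z\<close> is an arbitrary real so that bounded changes of the degree,
  of either sign, are absorbed without truncated subtraction.\<close>

lemma gbinomial_shift_lim: "(\<lambda>j. (real j + z gchoose N) / real j ^ N) \<longlonglongrightarrow> 1 / fact N"
proof -
  have "(\<lambda>j. (real j + z - real i) / real j) \<longlonglongrightarrow> 1" for i
  proof (rule Lim_transform_eventually)
    show "(\<lambda>j. 1 + (z - real i) / real j) \<longlonglongrightarrow> 1"
      using tendsto_add[OF tendsto_const lim_const_over_n, of 1 "z - real i"] by simp
    show "\<forall>\<^sub>F j in sequentially. 1 + (z - real i) / real j = (real j + z - real i) / real j"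
      using eventually_gt_at_top[of 0] by eventually_elim (simp add: field_simps)
  qed
  then have "(\<lambda>j. (\<Prod>i = 0..<N. (real j + z - real i) / real j) / fact N) \<longlonglongrightarrow> (\<Prod>i = 0..<N. 1) / fact N"
    by (intro tendsto_divide tendsto_prod) auto
  then show ?thesis
    by (simp add: gbinomial_prod_rev prod_dividef field_simps)
qed

lemma binomial_shift_lim: "(\<lambda>j. real ((j - i + N) choose N) / real j ^ N) \<longlonglongrightarrow> 1 / fact N"
proof (rule Lim_transform_eventually[OF gbinomial_shift_lim[of "real N - real i"]])
  show "\<forall>\<^sub>F j in sequentially. (real j + (real N - real i) gchoose N) / real j ^ N = real ((j - i + N) choose N) / real j ^ N"
    using eventually_ge_at_top[of i]
    by eventually_elim (simp add: binomial_gbinomial of_nat_diff algebra_simps)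
qed

text \<open>Expanding r/(1-t)^(N+1) gives finitely many shifted binomials weighted by the
  coefficients of \<open>r\<close>; each has the same leading term, so the weights add up to
  r(1).\<close>

lemma fps_nth_lim:
  assumes "(1 - fps_X) ^ Suc N * F = fps_of_poly (r :: int poly)"
  shows "(\<lambda>j. real_of_int (fps_nth F j) / real j ^ N) \<longlonglongrightarrow> real_of_int (poly r 1) / fact N"
proof -
  have "F = ((1 - fps_X) ^ Suc N * Abs_fps (\<lambda>k. int ((k + N) choose N))) * F"
    by (simp only: one_minus_fps_X_power_binomial mult_1)
  also have "\<dots> = fps_of_poly r * Abs_fps (\<lambda>k. int ((k + N) choose N))"
    by (simp add: ac_simps flip: assms)
  finally have F: "fps_nth F j = (\<Sum>i=0..j. coeff r i * int ((j - i + N) choose N))" for j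
    by (metis (no_types, lifting) fps_mult_nth fps_nth_Abs_fps fps_of_poly_nth sum.cong)
  have "(\<lambda>j. \<Sum>i\<le>degree r. real_of_int (coeff r i) * (real ((j - i + N) choose N) / real j ^ N))
      \<longlonglongrightarrow> (\<Sum>i\<le>degree r. real_of_int (coeff r i) * (1 / fact N))"
    by (intro tendsto_sum tendsto_mult tendsto_const binomial_shift_lim)
  also have "(\<Sum>i\<le>degree r. real_of_int (coeff r i) * (1 / fact N)) = real_of_int (poly r 1) / fact N"
    by (simp add: poly_altdef sum_divide_distrib)
  finally show ?thesis
  proof (rule Lim_transform_eventually)
    show "\<forall>\<^sub>F j in sequentially. (\<Sum>i\<le>degree r. real_of_int (coeff r i) * (real ((j - i + N) choose N) / real j ^ N))
        = real_of_int (fps_nth F j) / real j ^ N"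
      using eventually_ge_at_top[of "degree r"]
    proof eventually_elim
      case (elim j)
      have "fps_nth F j = (\<Sum>i\<le>degree r. coeff r i * int ((j - i + N) choose N))"
        unfolding F using elim by (intro sum.mono_neutral_right) (auto simp: coeff_eq_0)
      then show ?case by (simp add: sum_divide_distrib)
    qed
  qed
qed

text \<open>A telescoping sum in which Pascal's rule evaluates each step.\<close>

lemma num_mons_diff:
  assumes "card (UNIV :: 'v::finite set) = Suc N" "m \<le> k"
  shows "real (num_mons TYPE('v) k) - real (num_mons TYPE('v) (k - m)) =
    (\<Sum>i<m. real k - real i + real N gchoose N)"
  using assms(2)
proof (induction m)
  case (Suc m)
  define l where "l = k - Suc m"
  have km: "k - m = Suc l" using Suc.prems by (simp add: l_def)
  have "real (num_mons TYPE('v) (k - m)) - real (num_mons TYPE('v) (k - Suc m)) = real ((k - m + N) choose N)"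
    unfolding km l_def[symmetric] by (simp add: num_mons_eq_binomial assms(1))
  also have "\<dots> = (real k - real m + real N gchoose N)"
  proof -
    have "real (k - m + N) = real k - real m + real N" using Suc.prems by (simp add: of_nat_diff)
    then show ?thesis by (simp only: binomial_gbinomial)
  qed
  finally show ?case using Suc by simp
qed simp

text \<open>The limit does not depend on \<open>a\<close> and \<open>b\<close>; this is what closes
  the gap between the two bounds for one irreducible factor.\<close>

lemma num_mons_diff_lim:
  assumes "card (UNIV :: 'v::finite set) = Suc N"
  shows "(\<lambda>j. (real (num_mons TYPE('v) (j + a - b)) - real (num_mons TYPE('v) (j + a - b - m))) / real j ^ N)
    \<longlonglongrightarrow> real m / fact N"
proof -
  have "(\<lambda>j. \<Sum>i<m. (real j + (real a - real b - real i + real N) gchoose N) / real j ^ N) \<longlonglongrightarrow> (\<Sum>i<m. 1 / fact N)"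
    by (intro tendsto_sum gbinomial_shift_lim)
  also have "(\<Sum>i<m. 1 / fact N) = real m / fact N" by simp
  finally show ?thesis
  proof (rule Lim_transform_eventually)
    show "\<forall>\<^sub>F j in sequentially. (\<Sum>i<m. (real j + (real a - real b - real i + real N) gchoose N) / real j ^ N) =
        (real (num_mons TYPE('v) (j + a - b)) - real (num_mons TYPE('v) (j + a - b - m))) / real j ^ N"
      using eventually_ge_at_top[of "b + m"]
    proof eventually_elim
      case (elim j)
      then have "real j + (real a - real b - real i + real N) = real (j + a - b) - real i + real N" for i
        by (simp add: of_nat_diff)
      moreover have "m \<le> j + a - b" using elim by simp
      ultimately show ?case
        by (simp only: num_mons_diff[OF assms] sum_divide_distrib)
    qed
  qed
qed

lemma exists_irreducible_power_factor:
  fixes f :: "('v::{finite,linorder}, 'k::field) mpoly"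
  assumes "f \<noteq> 0" "0 < tdeg f"
  obtains g e f' where "irreducible g" "1 \<le> e" "\<not> g dvd f'" "f = g ^ e * f'"
proof -
  have "\<not> f dvd 1" using assms by (simp add: mpoly_dvd_1_iff)
  then obtain g where g: "irreducible g" "g dvd f" using exists_irreducible_factor assms by blast
  have "g \<noteq> 0" "\<not> g dvd 1" using g by (auto simp: irreducible_def)
  then have tg: "0 < tdeg g" by (simp add: mpoly_dvd_1_iff)
  define P where "P k \<longleftrightarrow> \<not> g ^ Suc k dvd f" for k
  have "P (tdeg f)"
    unfolding P_def
  proof
    assume "g ^ Suc (tdeg f) dvd f"
    then have "Suc (tdeg f) * tdeg g \<le> tdeg f"
      using tdeg_dvd_le[of "g ^ Suc (tdeg f)" f] assms \<open>g \<noteq> 0\<close> by (simp add: tdeg_power del: power_Suc)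
    moreover have "Suc (tdeg f) * 1 \<le> Suc (tdeg f) * tdeg g" using tg by (intro mult_le_mono2) simp
    ultimately show False by simp
  qed
  define e where "e = (LEAST k. P k)"
  have Pe: "P e" unfolding e_def using \<open>P (tdeg f)\<close> by (rule LeastI)
  have "\<not> P 0" using g by (simp add: P_def)
  then obtain e' where e': "e = Suc e'" using Pe by (cases e) auto
  then have "\<not> P e'" unfolding e_def by (metis lessI not_less_Least)
  then have "g ^ e dvd f" by (simp add: P_def e')
  then obtain f' where f': "f = g ^ e * f'" ..
  have "\<not> g dvd f'"
  proof
    assume "g dvd f'"
    then have "g ^ e * g dvd g ^ e * f'" by (intro mult_dvd_mono) auto
    with Pe show False by (simp add: P_def f' mult.commute)
  qed
  with that[of g e f'] g f' e' show thesis by simp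
qed

text \<open>Induction on the degree: a nonzero constant has codimension 0, and splitting off
  \<open>g ^ e\<close> adds \<open>e * tdeg g\<close> to the growth constant by squeezing.
  \<open>N\<close> is n - 1.\<close>

lemma codim_Dlog_lim:
  fixes f :: "('n::{finite,linorder}, 'k::field_char_0) mpoly"
  assumes N: "card (UNIV :: 'n set) = Suc N" and "f \<noteq> 0"
  shows "(\<lambda>j. (real (Suc N * num_mons TYPE('n) j) - real (kdim (Dlog f \<inter> vec_le j))) / real j ^ N)
    \<longlonglongrightarrow> real (tdeg f) / fact N"
  using assms(2)
proof (induction "tdeg f" arbitrary: f rule: less_induct)
  case less
  define H where "H f j = real (kdim (Dlog f \<inter> vec_le j))" for f :: "('n, 'k) mpoly" and j
  define s where "s j = real (num_mons TYPE('n) j)" for j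
  show ?case
  proof (cases "tdeg f = 0")
    case True
    then show ?thesis using less.prems
      by (simp add: Dlog_const kdim_vec_le N)
  next
    case False
    then obtain g e f' where g: "irreducible g" and e: "1 \<le> e" and f': "\<not> g dvd f'" and f: "f = g ^ e * f'"
      using exists_irreducible_power_factor[OF less.prems] by blast
    have nz: "g \<noteq> 0" "f' \<noteq> 0" using less.prems f e by auto
    have "\<not> g dvd 1" using g by (auto simp: irreducible_def)
    then have tg: "0 < tdeg g" using nz by (simp add: mpoly_dvd_1_iff)
    define m where "m = e * tdeg g"
    have tf: "tdeg f = m + tdeg f'" using nz by (simp add: f m_def tdeg_mult tdeg_power)
    have "0 < m" using e tg by (simp add: m_def)
    then have IH: "(\<lambda>j. (real (Suc N * num_mons TYPE('n) j) - H f' j) / real j ^ N) \<longlonglongrightarrow> real (tdeg f') / fact N"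
      unfolding H_def using tf nz by (intro less.hyps) auto
    have "(\<lambda>j. (H f' j - H f j) / real j ^ N) \<longlonglongrightarrow> real m / fact N"
    proof (rule tendsto_sandwich)
      show "(\<lambda>j. (s (j + 0 - tdeg f') - s (j + 0 - tdeg f' - m)) / real j ^ N) \<longlonglongrightarrow> real m / fact N"
        unfolding s_def by (rule num_mons_diff_lim[OF N])
      show "(\<lambda>j. (s (j + (tdeg g - 1) - 0) - s (j + (tdeg g - 1) - 0 - m)) / real j ^ N) \<longlonglongrightarrow> real m / fact N"
        unfolding s_def by (rule num_mons_diff_lim[OF N])
      show "\<forall>\<^sub>F j in sequentially. (s (j + 0 - tdeg f') - s (j + 0 - tdeg f' - m)) / real j ^ N \<le> (H f' j - H f j) / real j ^ N"
        using eventually_ge_at_top[of "tdeg f' + m"]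
      proof eventually_elim
        case (elim j)
        from kdim_Dlog_split_lower[OF g f' e, of j] elim
        have "H f j + s (j - tdeg f') \<le> H f' j + s (j - tdeg f' - m)"
          unfolding H_def s_def f m_def by (metis (no_types, lifting) of_nat_add of_nat_le_iff)
        then show ?case by (intro divide_right_mono) auto
      qed
      show "\<forall>\<^sub>F j in sequentially. (H f' j - H f j) / real j ^ N \<le> (s (j + (tdeg g - 1) - 0) - s (j + (tdeg g - 1) - 0 - m)) / real j ^ N"
        using eventually_ge_at_top[of m]
      proof eventually_elim
        case (elim j)
        from kdim_Dlog_split_upper[OF g f' e, of j] elim
        have "H f' j + s (j + (tdeg g - 1) - m) \<le> H f j + s (j + (tdeg g - 1))"
          unfolding H_def s_def f m_def by (metis (no_types, lifting) of_nat_add of_nat_le_iff)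
        then show ?case by (intro divide_right_mono) auto
      qed
    qed
    moreover have "(real (Suc N * num_mons TYPE('n) j) - H f' j) / real j ^ N + (H f' j - H f j) / real j ^ N =
        (real (Suc N * num_mons TYPE('n) j) - H f j) / real j ^ N" for j
      by (simp flip: add_divide_distrib)
    ultimately have "(\<lambda>j. (real (Suc N * num_mons TYPE('n) j) - H f j) / real j ^ N)
        \<longlonglongrightarrow> real (tdeg f') / fact N + real m / fact N"
      using tendsto_add[OF IH, of "\<lambda>j. (H f' j - H f j) / real j ^ N"] by (simp only:)
    then show ?thesis by (simp add: tf H_def add_divide_distrib add.commute)
  qed
qed

theorem mainTheorem14:
  fixes f :: "('n::{finite,linorder}, 'k::field_char_0) mpoly"
  assumes "f \<noteq> 0"
  shows "has_chi (card (UNIV :: 'n set) + 1) (Dlog_h f) (int (tdeg f))"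
proof -
  obtain N where N: "card (UNIV :: 'n set) = Suc N"
    by (metis UNIV_not_empty card_gt_0_iff finite_UNIV gr0_implies_Suc)
  define H where "H = Abs_fps (\<lambda>j. int (kdim (Dlog f \<inter> vec_le j)))"
  define C where "C = Abs_fps (\<lambda>j. int (Suc N * num_mons TYPE('n) j) - int (kdim (Dlog f \<inter> vec_le j)))"
  obtain p :: "int poly" where p: "fps_of_poly p = (1 - fps_X) ^ Suc (Suc N) * H"
    using Hilbert_Serre_filtered[OF submodule_Dlog, of f] by (auto simp: N H_def simp del: power_Suc)
  \<comment> \<open>The numerator of the codimension series over (1-t)^(n+1), as the space of all
    derivations has the constant numerator n.\<close>
  define r where "r = [:int (Suc N):] - p"
  have "C = fps_const (int (Suc N)) * Abs_fps (\<lambda>k. int ((k + Suc N) choose Suc N)) - H"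
    by (rule fps_ext) (simp add: C_def H_def num_mons_eq_binomial N distrib_right del: binomial_Suc_Suc)
  then have "(1 - fps_X) ^ Suc (Suc N) * C =
      fps_const (int (Suc N)) * ((1 - fps_X) ^ Suc (Suc N) * Abs_fps (\<lambda>k. int ((k + Suc N) choose Suc N)))
        - (1 - fps_X) ^ Suc (Suc N) * H"
    by (simp only: right_diff_distrib mult.left_commute)
  also have "\<dots> = fps_of_poly r"
    unfolding one_minus_fps_X_power_binomial p[symmetric] by (simp add: r_def fps_of_poly_diff fps_of_poly_const)
  finally have C: "(1 - fps_X) ^ Suc (Suc N) * C = fps_of_poly r" .
  have lim: "(\<lambda>j. real_of_int (fps_nth C j) / real j ^ N) \<longlonglongrightarrow> real (tdeg f) / fact N"
    using codim_Dlog_lim[OF N assms] by (simp add: C_def)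
  \<comment> \<open>The codimension grows one order slower than a pole of order n + 1 would allow,
    so \<open>r\<close> vanishes at 1.\<close>
  have "(\<lambda>j. real_of_int (fps_nth C j) / real j ^ Suc N) \<longlonglongrightarrow> 0"
    using tendsto_mult[OF lim lim_1_over_n] by (simp add: mult.commute)
  with fps_nth_lim[OF C] have "poly r 1 = 0"
    using LIMSEQ_unique by fastforce
  then obtain r' where r': "r = [:-1, 1:] * r'" by (metis dvdE poly_eq_0_iff_dvd)
  have lin: "fps_of_poly [:-1, 1:] = - (1 - fps_X :: int fps)"
    by (simp add: fps_of_poly_pCons fps_const_neg[symmetric] del: fps_const_neg)
  have "(1 - fps_X) * ((1 - fps_X) ^ Suc N * C) = (1 - fps_X) * fps_of_poly (- r')"
    using C unfolding r' fps_of_poly_mult lin by (simp add: fps_of_poly_uminus mult.assoc)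
  then have "(1 - fps_X) ^ Suc N * C = fps_of_poly (- r')"
    using one_minus_fps_X_neq_0 by (simp del: power_Suc)
  \<comment> \<open>With the factor t - 1 cancelled, the pole order matches the known growth, and
    the two expressions for the limit determine r'(1).\<close>
  from LIMSEQ_unique[OF fps_nth_lim[OF this] lim] have "real_of_int (- poly r' 1) = real (tdeg f)"
    by (simp add: field_simps)
  then have "poly r' 1 = - int (tdeg f)" by linarith
  moreover have "p = [:int (Suc N):] - r" by (simp add: r_def)
  then have "poly (pderiv p) 1 = - poly r' 1" by (simp add: r' pderiv_diff pderiv_mult pderiv_pCons)
  moreover have "hilb_series (Dlog_h f) = H"
    by (simp add: hilb_series_def H_def kdim_graded_piece_Dlog_h)
  ultimately show ?thesis unfolding has_chi_def using p by (intro exI[of _ p]) (simp add: N)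
qed

end
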